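(* Assume the genericity condition $\overline\sigma_{n-p}:=\sigma_{n-p}(AQ_2)>\widetilde\sigma_{n-p+1}:=\sigma_{n-p+1}([AQ_2\ \ \zeta r_{C}])$ holds, so that the TLSE problem has a unique solution $x=\phi([L\ \ h])$. Then $\Delta x=\phi([L+\Delta L\ \ h+\Delta h])-\phi([L\ \ h])$ satisfies $$\Delta x=\overline K_{L,h}\,\mathrm{vec}([\Delta L\ \ \Delta h])+\mathcal O(\|[\Delta L\ \ \Delta h]\|_F^2)=\big[(x^T\otimes H_1)-\overline H_2\ \ \ -H_1\big]\begin{bmatrix}\mathrm{vec}(\Delta L)\\ \mathrm{vec}(\Delta h)\end{bmatrix}+\mathcal O(\|[\Delta L\ \ \Delta h]\|_F^2)$$ as $\|[\Delta L\ \ \Delta h]\|_F\to 0$, where $\overline K_{L,h}=\big[(x^T\otimes H_1)-\overline H_2\ \ \ -H_1\big]$, $$H_1=2\rho^{-2}\mathcal K x t^T-[C_A^\dagger\ \ \ \mathcal K A^T],\qquad \overline H_2=\mathcal K(I_n\otimes t^T),$$ $\rho=\sqrt{1+\|x\|_2^2}$, and $t^T=\big[-r^T(\widetilde A\widetilde C^\dagger)\ \ \ r^T\big]$ with $r=Ax-b$.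
   Context: TLSE problem (total least squares with linear equality constraint): given $A\in\mathbb R^{q\times n}$ ($q>n$), $b\in\mathbb R^q$, $C\in\mathbb R^{p\times n}$, $d\in\mathbb R^p$, where $C$ has full row rank $p$ and $\begin{bmatrix}C\\ A\end{bmatrix}$ has full column rank $n$, solve $$\min_{E,f}\|[E\ \ f]\|_F\quad\text{subject to}\quad (A+E)x=b+f,\ \ Cx=d.$$ Notation: $\|\cdot\|_F$ is the Frobenius norm, $\sigma_j(M)$ is the $j$-th largest singular value of $M$, $M^\dagger$ is the Moore–Penrose inverse, $\mathrm{vec}$ stacks the columns of a matrix, $\otimes$ is the Kronecker product. $\widetilde A=[A\ \ b]$, $\widetilde C=[C\ \ d]$, $L=\begin{bmatrix}C\\ A\end{bmatrix}\in\mathbb R^{m\times n}$, $h=\begin{bmatrix}d\\ b\end{bmatrix}\in\mathbb R^{m}$, $m=p+q$. Let $C^T=[Q_1\ \ Q_2]\begin{bmatrix}R_1\\0\end{bmatrix}=Q_1R_1$ be a QR factorization ($[Q_1\ \ Q_2]$ orthogonal, $Q_1\in\mathbb R^{n\times p}$, $R_1\in\mathbb R^{p\times p}$), $x_{C}=C^\dagger d$, $r_{C}=Ax_{C}-b$, $\zeta=(1+\|x_{C}\|_2^2)^{-1/2}$. Under the genericity condition in the claim, the TLSE problem has a unique solution, namely $$x=C^\dagger d-Q_2S_{11}^{-1}Q_2^TA^Tr_{C}=C_A^\dagger d+\mathcal K A^Tb,$$ where $S_{11}=Q_2^TA^TAQ_2-\widetilde\sigma_{n-p+1}^2I_{n-p}$,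 $\mathcal K=Q_2S_{11}^{-1}Q_2^T$, and $C_A^\dagger=(I_n-\mathcal KA^TA)C^\dagger$. The map $\phi$ sends input data $[L\ \ h]\in\mathbb R^{m\times n}\times\mathbb R^m$ to the corresponding TLSE solution $x$ (it is defined on a neighborhood of the given data, since perturbed data with sufficiently small perturbations $[\Delta L\ \ \Delta h]$ also give a uniquely solvable TLSE problem). *)

theory Defs
  imports "HOL-Analysis.Analysis" "HOL-Library.Landau_Symbols"
begin

text \<open>
  An r-by-c matrix is a \<^typ>\<open>real^'c^'r\<close>. Block matrices are indexed by sum types, and an
  adjoined single column is indexed by the one-element type \<^typ>\<open>1\<close>.
  On matrices \<^const>\<open>norm\<close> is the Frobenius norm; on vectors it is the Euclidean norm.
\<close>

lemma norm_matrix_frobenius: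
  fixes M :: "real^'c^'r"
  shows "norm M = sqrt (\<Sum>i\<in>UNIV. \<Sum>j\<in>UNIV. (M $ i $ j)\<^sup>2)"
  by (simp add: norm_vec_def L2_set_def sum_nonneg)

definition vappend :: "real^'a \<Rightarrow> real^'b \<Rightarrow> real^('a + 'b)" where
  "vappend u v = (\<chi> k. case k of Inl i \<Rightarrow> u $ i | Inr i \<Rightarrow> v $ i)"

definition hcat :: "real^'a^'r \<Rightarrow> real^'b^'r \<Rightarrow> real^('a + 'b)^'r" where
  "hcat M N = (\<chi> i. vappend (M $ i) (N $ i))"

definition vcat :: "real^'c^'a \<Rightarrow> real^'c^'b \<Rightarrow> real^'c^('a + 'b)" where
  "vcat M N = (\<chi> k. case k of Inl i \<Rightarrow> M $ i | Inr i \<Rightarrow> N $ i)"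

definition augment :: "real^'c^'r \<Rightarrow> real^'r \<Rightarrow> real^('c + 1)^'r" where
  "augment M v = hcat M (columnvector v :: real^1^'r)"

lemma norm_augment: "norm (augment M v) = norm (M, v)"
proof -
  have "(norm (augment M v))\<^sup>2 = (norm M)\<^sup>2 + (norm v)\<^sup>2"
    unfolding augment_def hcat_def vappend_def columnvector_def norm_vec_def L2_set_def
    by (simp add: sum_nonneg UNIV_Plus_UNIV[symmetric] sum.Plus sum.distrib del: UNIV_Plus_UNIV)
  then show ?thesis
    by (simp add: norm_Pair real_sqrt_unique)
qed

text \<open>
  The stacked columns of \<open>M\<close>: the component \<open>(j, i)\<close> is the \<open>i\<close>-th entry of column \<open>j\<close>.
  Pairs are read lexicographically (first component = block), both here and in the row and
  column indices of Kronecker products.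
\<close>

definition vec_cols :: "real^'c^'r \<Rightarrow> real^('c \<times> 'r)" where
  "vec_cols M = (\<chi> k. case k of (j, i) \<Rightarrow> M $ i $ j)"

definition kronecker :: "real^'b^'a \<Rightarrow> real^'d^'c \<Rightarrow> real^('b \<times> 'd)^('a \<times> 'c)" where
  "kronecker M N =
     (\<chi> row col. case (row, col) of ((i, k), (j, l)) \<Rightarrow> M $ i $ j * N $ k $ l)"

text \<open>
  If one factor of a Kronecker product has a single row, the row index of the product carries a
  trivial component of type \<^typ>\<open>1\<close>, which is removed by the following identifications.
\<close>

definition drop_unit_left :: "real^'c^(1 \<times> 'r) \<Rightarrow> real^'c^'r" where
  "drop_unit_left M = (\<chi> i. M $ (1, i))"

definition drop_unit_right :: "real^'c^('r \<times> 1) \<Rightarrow> real^'c^'r" where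
  "drop_unit_right M = (\<chi> i. M $ (i, 1))"

text \<open>
  The vector of stacked columns of an augmented matrix \<open>[M v]\<close> is the stacked columns of \<open>M\<close>
  followed by \<open>v\<close>, but the index types \<open>('c + 1) \<times> 'r\<close> and \<open>('c \<times> 'r) + 'r\<close> differ.
  The following carries the columns of a matrix from the second index type to the first.
\<close>

definition reindex_cols :: "real^(('c::finite \<times> 'r::finite) + 'r)^'k \<Rightarrow> real^(('c + 1) \<times> 'r)^'k" where
  "reindex_cols N =
     (\<chi> i col. case col of (Inl j, l) \<Rightarrow> N $ i $ Inl (j, l) | (Inr _, l) \<Rightarrow> N $ i $ Inr l)"

text \<open>The Moore--Penrose inverse; every real matrix has exactly one.\<close>

definition pinv :: "real^'c^'r \<Rightarrow> real^'r^'c" where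
  "pinv M = (THE X. M ** X ** M = M \<and> X ** M ** X = X \<and>
     transpose (M ** X) = M ** X \<and> transpose (X ** M) = X ** M)"

text \<open>
  The singular values of \<open>M\<close> are the square roots of the eigenvalues of \<open>M\<^sup>T M\<close>, listed in
  decreasing order with multiplicity. The list has as many entries as \<open>M\<close> has columns, so for a
  matrix with more columns than rows it is the usual list padded with zeros at the end.
  The index \<open>j\<close> in \<open>singular_value j M\<close> starts at 1.
\<close>

definition singular_value_mult :: "real^'c^'r \<Rightarrow> real \<Rightarrow> nat" where
  "singular_value_mult M s =
     (if 0 \<le> s then dim {v. (transpose M ** M) *v v = s\<^sup>2 *\<^sub>R v} else 0)"

definition singular_values :: "real^'c^'r \<Rightarrow> real list" where
  "singular_values M = rev (sorted_list_of_multiset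
     (\<Sum>s | singular_value_mult M s > 0. replicate_mset (singular_value_mult M s) s))"

definition singular_value :: "nat \<Rightarrow> real^'c^'r \<Rightarrow> real" where
  "singular_value j M = singular_values M ! (j - 1)"

definition tlse_feasible ::
  "real^'n^'q \<Rightarrow> real^'q \<Rightarrow> real^'n^'p \<Rightarrow> real^'p \<Rightarrow> real^'n^'q \<Rightarrow> real^'q \<Rightarrow> real^'n \<Rightarrow> bool" where
  "tlse_feasible A b C d E f x \<longleftrightarrow> (A + E) *v x = b + f \<and> C *v x = d"

definition tlse_solution ::
  "real^'n^'q \<Rightarrow> real^'q \<Rightarrow> real^'n^'p \<Rightarrow> real^'p \<Rightarrow> real^'n \<Rightarrow> bool" where
  "tlse_solution A b C d x \<longleftrightarrow>
     (\<exists>E f. tlse_feasible A b C d E f x \<and>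
        (\<forall>E' f' x'. tlse_feasible A b C d E' f' x' \<longrightarrow>
           norm (augment E f) \<le> norm (augment E' f')))"

definition upper_rows :: "'a^('p::finite + 'q::finite) \<Rightarrow> 'a^'p" where
  "upper_rows M = (\<chi> i. M $ Inl i)"

definition lower_rows :: "'a^('p::finite + 'q::finite) \<Rightarrow> 'a^'q" where
  "lower_rows M = (\<chi> i. M $ Inr i)"

text \<open>Input data are passed as \<open>L = [C; A]\<close> and \<open>h = [d; b]\<close>.\<close>

definition tlse_solution_data :: "real^'n^('p::finite + 'q::finite) \<Rightarrow> real^('p + 'q) \<Rightarrow> real^'n \<Rightarrow> bool" where
  "tlse_solution_data L h x \<longleftrightarrow>
     tlse_solution (lower_rows L) (lower_rows h) (upper_rows L) (upper_rows h) x"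

definition tlse_uniquely_solvable :: "real^'n^('p::finite + 'q::finite) \<Rightarrow> real^('p + 'q) \<Rightarrow> bool" where
  "tlse_uniquely_solvable L h \<longleftrightarrow>
     rank (upper_rows L) = CARD('p) \<and> rank L = CARD('n) \<and> (\<exists>!x. tlse_solution_data L h x)"

definition tlse_map :: "real^'n^('p::finite + 'q::finite) \<Rightarrow> real^('p + 'q) \<Rightarrow> real^'n" where
  "tlse_map L h = (THE x. tlse_solution_data L h x)"

end

theory Submission
  imports Defs
begin

text \<open>
  For fixed \<open>x\<close> with \<open>C x = d\<close>, the cheapest correction \<open>[E f]\<close> has Frobenius norm
  \<open>|A x - b| / sqrt (1 + |x|\<^sup>2)\<close>, so a TLSE solution is a minimiser of this ratio on the affine
  space \<open>C x = d\<close> (\<open>tlse_solution_iff_minimizes_ratio\<close>). If the residual \<open>r\<close> and the negated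
  Lagrange multipliers of the constraint are collected in one vector \<open>t\<close>, then the first-order
  conditions are the polynomial system

    \<open>L\<^sup>T t + (h \<bullet> t) x = 0\<close>,  \<open>L x - h = (0, r)\<close>,

  in which \<open>- (h \<bullet> t)\<close> is the square \<open>\<sigma>\<^sup>2\<close> of the value of the ratio. Completing the square shows that
  a solution of this system is the unique TLSE solution as soon as \<open>|A v|\<^sup>2 > \<sigma>\<^sup>2 |v|\<^sup>2\<close> for all
  \<open>v \<noteq> 0\<close> in the kernel of \<open>C\<close> (\<open>tlse_critical_unique_solution\<close>).

  The genericity condition yields such a solution. The last entry in the list of singular values is
  the minimum of \<open>|M v| / |v|\<close>, by the spectral theorem for \<open>M\<^sup>T M\<close>. The gap between the two
  singular values forces the last component of a right singular vector of \<open>[A Q\<^sub>2, \<zeta> r\<^sub>C]\<close> for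
  \<open>\<sigma>tilde\<close> to be nonzero; scaled suitably, the vector gives a critical point with \<open>\<sigma> = \<sigma>tilde\<close>
  (\<open>tlse_critical_from_singular_vector\<close>). The same gap is the positivity condition on the kernel
  of \<open>C\<close>, which is the range of \<open>Q\<^sub>2\<close>.

  For perturbed data \<open>\<Delta>\<close>, the increment \<open>\<delta>\<close> of \<open>(x, t)\<close> has to satisfy
  \<open>J \<delta> + B \<Delta> + R \<delta> \<Delta> = 0\<close> with \<open>J\<close> and \<open>B\<close> linear and \<open>R\<close> of second order. Positivity makes
  \<open>J\<close> injective (\<open>inj_kkt_jacobian\<close>), and Brouwer's theorem then provides a root whose distance
  from \<open>g = - J\<^sup>-\<^sup>1 B \<Delta>\<close> is of second order in \<open>\<Delta>\<close> (\<open>perturbed_zero_to_second_order\<close>). The rank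
  and positivity conditions are open, so this root carries the unique solution of the perturbed
  problem. Hence the derivative of the solution map is the \<open>x\<close>-part of \<open>g\<close>
  (\<open>tlse_map_expansion\<close>). It remains to solve \<open>J g + B \<Delta> = 0\<close> for that part: the matrix \<open>K\<close>
  annihilates the range of \<open>C\<^sup>T\<close> and inverts \<open>A\<^sup>T A - \<sigma>\<^sup>2 I\<close> on the kernel of \<open>C\<close>, which
  gives the stated formula (\<open>tlse_derivative_formula\<close>).
\<close>

section \<open>Block vectors and block matrices\<close>

lemma sum_UNIV_Plus:
  fixes f :: "'a::finite + 'b::finite \<Rightarrow> 'c::comm_monoid_add"
  shows "(\<Sum>k\<in>UNIV. f k) = (\<Sum>i\<in>UNIV. f (Inl i)) + (\<Sum>j\<in>UNIV. f (Inr j))"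
  by (simp add: UNIV_Plus_UNIV[symmetric] sum.Plus del: UNIV_Plus_UNIV)

lemma vappend_nth [simp]: "vappend u v $ Inl i = u $ i" "vappend u v $ Inr j = v $ j"
  by (simp_all add: vappend_def)

lemma vcat_nth [simp]: "vcat M N $ Inl i = M $ i" "vcat M N $ Inr j = N $ j"
  by (simp_all add: vcat_def)

lemma rows_nth [simp]: "upper_rows M $ i = M $ Inl i" "lower_rows M $ j = M $ Inr j"
  by (simp_all add: upper_rows_def lower_rows_def)

lemma vec_eq_Plus_iff: "u = v \<longleftrightarrow> (\<forall>i. u $ Inl i = v $ Inl i) \<and> (\<forall>j. u $ Inr j = v $ Inr j)"
  for u v :: "'c^('a::finite + 'b::finite)"
  unfolding vec_eq_iff by (metis sumE)

lemma vappend_rows [simp]: "vappend (upper_rows v) (lower_rows v) = v"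
  by (simp add: vec_eq_Plus_iff)

lemma rows_vappend [simp]: "upper_rows (vappend u v) = u" "lower_rows (vappend u v) = v"
  by (simp_all add: vec_eq_iff)

lemma rows_vcat [simp]: "upper_rows (vcat M N) = M" "lower_rows (vcat M N) = N"
  by (simp_all add: vec_eq_iff)

lemma inner_Plus:
  fixes u v :: "real^('a::finite + 'b::finite)"
  shows "u \<bullet> v = upper_rows u \<bullet> upper_rows v + lower_rows u \<bullet> lower_rows v"
  by (simp add: inner_vec_def sum_UNIV_Plus)

lemma rows_matrix_vector_mult:
  fixes M :: "real^'c^('a::finite + 'b::finite)"
  shows "upper_rows (M *v x) = upper_rows M *v x" "lower_rows (M *v x) = lower_rows M *v x"
  by (simp_all add: vec_eq_iff matrix_vector_mult_def)

lemma rows_vector_matrix_mult: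
  fixes M :: "real^'c^('a::finite + 'b::finite)"
  shows "v v* M = upper_rows v v* upper_rows M + lower_rows v v* lower_rows M"
  by (simp add: vec_eq_iff vector_matrix_mult_def sum_UNIV_Plus)

lemma rows_add [simp]:
  "upper_rows (u + v) = upper_rows u + upper_rows v" "lower_rows (u + v) = lower_rows u + lower_rows v"
  for u v :: "'c::ab_group_add^('a::finite + 'b::finite)"
  by (simp_all add: vec_eq_iff)

lemma rows_diff [simp]:
  "upper_rows (u - v) = upper_rows u - upper_rows v" "lower_rows (u - v) = lower_rows u - lower_rows v"
  for u v :: "'c::ab_group_add^('a::finite + 'b::finite)"
  by (simp_all add: vec_eq_iff)

lemma rows_zero [simp]: "upper_rows (0 :: real^('a::finite + 'b::finite)) = 0"
    "lower_rows (0 :: real^('a::finite + 'b::finite)) = 0"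
  by (simp_all add: vec_eq_iff)

lemma rows_scaleR [simp]:
  "upper_rows (c *\<^sub>R v) = c *\<^sub>R upper_rows v" "lower_rows (c *\<^sub>R v) = c *\<^sub>R lower_rows v"
  for v :: "real^('a::finite + 'b::finite)"
  by (simp_all add: vec_eq_iff)

lemma vappend_add: "vappend u v + vappend u' v' = vappend (u + u') (v + v')"
  by (simp add: vec_eq_Plus_iff)

lemma vappend_scaleR: "c *\<^sub>R vappend u v = vappend (c *\<^sub>R u) (c *\<^sub>R v)"
  by (simp add: vec_eq_Plus_iff)

lemma hcat_vappend: "hcat M N *v vappend u v = M *v u + N *v v"
  by (simp add: vec_eq_iff hcat_def matrix_vector_mult_def sum_UNIV_Plus)

lemma hcat_mult: "hcat M N *v w = M *v upper_rows w + N *v lower_rows w"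
  using hcat_vappend[of M N "upper_rows w" "lower_rows w"] by simp

lemma sum_UNIV_Times: "(\<Sum>k\<in>UNIV. f k) = (\<Sum>i\<in>UNIV. \<Sum>j\<in>UNIV. f (i, j))"
  for f :: "'a::finite \<times> 'b::finite \<Rightarrow> 'c::comm_monoid_add"
  by (simp add: sum.cartesian_product UNIV_Times_UNIV)

lemma vector_augment: "u v* augment M v = vappend (u v* M) (\<chi> _. u \<bullet> v)"
  by (simp add: vec_eq_Plus_iff vector_matrix_mult_def augment_def hcat_def columnvector_def inner_vec_def)

lemma augment_vector: "augment M v *v w = M *v upper_rows w + (w $ Inr 1) *\<^sub>R v"
  by (simp add: vec_eq_iff matrix_vector_mult_def augment_def hcat_def columnvector_def sum_UNIV_Plus
      mult.commute)

lemma uminus_vector_matrix_mult: "(- u) v* M = - (u v* M)" for M :: "real^'n^'m"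
  by (simp add: vec_eq_iff vector_matrix_mult_def sum_negf)

lemma norm_matrix_vector_le:
  fixes E :: "real^'n^'m"
  shows "norm (E *v x) \<le> norm E * norm x"
proof -
  have "norm (E *v x) \<le> L2_set (\<lambda>i. norm (E $ i) * norm x) UNIV"
    unfolding norm_vec_def[of "E *v x"]
    by (rule L2_set_mono) (simp_all add: matrix_vector_mul_component Cauchy_Schwarz_ineq2)
  then show ?thesis by (simp add: L2_set_left_distrib norm_vec_def[of E])
qed

lemma norm_vector_matrix_le: "norm (t v* L) \<le> norm t * norm L" for L :: "real^'n^'m"
proof (cases "t v* L = 0")
  case False
  have "(norm (t v* L))\<^sup>2 = t \<bullet> (L *v (t v* L))"
    by (simp add: power2_norm_eq_inner dot_lmul_matrix)
  also have "\<dots> \<le> norm t * norm (L *v (t v* L))" by (rule norm_cauchy_schwarz)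
  also have "\<dots> \<le> norm t * (norm L * norm (t v* L))"
    by (intro mult_left_mono norm_matrix_vector_le) simp
  finally have "norm (t v* L) * norm (t v* L) \<le> norm t * norm L * norm (t v* L)"
    by (simp add: power2_eq_square mult.assoc)
  then show ?thesis using False by (simp add: mult_le_cancel_right)
qed simp

lemma bounded_bilinear_matrix_vector_mult:
  "bounded_bilinear ((*v) :: real^'n^'m \<Rightarrow> real^'n \<Rightarrow> real^'m)"
proof
  show "\<exists>K. \<forall>(a :: real^'n^'m) b. norm (a *v b) \<le> norm a * norm b * K"
    by (intro exI[of _ 1]) (simp add: norm_matrix_vector_le)
qed (auto simp: matrix_vector_mult_add_rdistrib matrix_vector_right_distrib matrix_vector_mult_scaleR
    scaleR_matrix_vector_assoc)

lemma bounded_bilinear_vector_matrix_mult: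
  "bounded_bilinear ((v*) :: real^'m \<Rightarrow> real^'n^'m \<Rightarrow> real^'n)"
proof
  show "\<exists>K. \<forall>a (b :: real^'n^'m). norm (a v* b) \<le> norm a * norm b * K"
    by (intro exI[of _ 1]) (simp add: norm_vector_matrix_le)
qed (auto simp: vector_matrix_left_distrib vector_matrix_mult_add_rdistrib scaleR_vector_matrix_assoc
    vector_scaleR_matrix_ac)

lemma bounded_linear_upper_rows:
  "bounded_linear (upper_rows :: real^'n^('p::finite + 'q::finite) \<Rightarrow> real^'n^'p)"
  by (rule linear_conv_bounded_linear[THEN iffD1]) (auto intro!: linearI simp: vec_eq_iff)

lemma bounded_linear_lower_rows:
  "bounded_linear (lower_rows :: real^'n^('p::finite + 'q::finite) \<Rightarrow> real^'n^'q)"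
  by (rule linear_conv_bounded_linear[THEN iffD1]) (auto intro!: linearI simp: vec_eq_iff)

section \<open>The smallest singular value\<close>

lemma inner_gram: "((transpose M ** M) *v v) \<bullet> w = (M *v v) \<bullet> (M *v w)"
  for M :: "real^'c^'r"
  by (simp add: matrix_vector_mul_assoc[symmetric] dot_lmul_matrix del: transpose_matrix_vector)
     (simp add: dot_lmul_matrix)

text \<open>
  A minimiser of \<open>|M v|\<close> over the unit sphere of an invariant subspace is an eigenvector of
  \<open>M\<^sup>T M\<close>: otherwise the residual \<open>z = M\<^sup>T M v - s\<^sup>2 v\<close> is a direction in that subspace, and a
  small step from \<open>v\<close> against \<open>z\<close> makes \<open>|M v|\<^sup>2 - s\<^sup>2 |v|\<^sup>2\<close> negative.
\<close>

lemma minimal_gain_eigenvector: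
  fixes M :: "real^'c^'r"
  assumes V: "subspace V" "V \<noteq> {0}"
    and inv: "\<And>v. v \<in> V \<Longrightarrow> (transpose M ** M) *v v \<in> V"
  obtains v s where "v \<in> V" "v \<noteq> 0" "0 \<le> s" "(transpose M ** M) *v v = s\<^sup>2 *\<^sub>R v"
    "\<And>w. w \<in> V \<Longrightarrow> s * norm w \<le> norm (M *v w)"
proof -
  let ?S = "sphere 0 1 \<inter> V"
  have "compact ?S"
    by (simp add: V(1) closed_subspace compact_Int_closed)
  moreover obtain u where "u \<in> V" "u \<noteq> 0"
    using V subspace_0 by blast
  then have "u /\<^sub>R norm u \<in> ?S"
    using V(1) by (simp add: subspace_scale)
  then have "?S \<noteq> {}" by blast
  moreover have "continuous_on ?S (\<lambda>v. norm (M *v v))"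
    by (intro continuous_on_norm matrix_vector_mult_linear_continuous_on)
  ultimately obtain v where v: "v \<in> ?S" and vmin: "\<And>w. w \<in> ?S \<Longrightarrow> norm (M *v v) \<le> norm (M *v w)"
    using continuous_attains_inf[of ?S "\<lambda>v. norm (M *v v)"] by blast
  have vv: "v \<bullet> v = 1" using v by (simp add: norm_eq_1)
  define s where "s = norm (M *v v)"
  have gain: "s * norm w \<le> norm (M *v w)" if "w \<in> V" for w
  proof (cases "w = 0")
    case False
    then have "w /\<^sub>R norm w \<in> ?S" using V(1) that by (simp add: subspace_scale)
    from vmin[OF this] False show ?thesis
      by (simp add: s_def matrix_vector_mult_scaleR field_simps)
  qed simp
  define z where "z = (transpose M ** M) *v v - s\<^sup>2 *\<^sub>R v"
  have zV: "z \<in> V" unfolding z_def using V(1) inv v by (simp add: subspace_diff subspace_scale)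
  define q where "q = (norm (M *v z))\<^sup>2 - s\<^sup>2 * (norm z)\<^sup>2"
  have "z = 0"
  proof (rule ccontr)
    assume "z \<noteq> 0"
    define c where "c = (norm z)\<^sup>2"
    have c: "c > 0" using \<open>z \<noteq> 0\<close> by (simp add: c_def)
    have zz: "(M *v v) \<bullet> (M *v z) - s\<^sup>2 * (v \<bullet> z) = c"
    proof -
      have "c = z \<bullet> z" by (simp add: c_def power2_norm_eq_inner)
      also have "\<dots> = ((transpose M ** M) *v v) \<bullet> z - s\<^sup>2 * (v \<bullet> z)"
        by (simp add: z_def algebra_simps inner_diff_left inner_diff_right)
      finally show ?thesis by (simp only: inner_gram)
    qed
    \<comment> \<open>the step from \<open>v\<close> against \<open>z\<close> changes the nonnegative form by \<open>e (e q - 2 c)\<close>\<close>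
    have key: "0 \<le> e * q - 2 * c" if "e > 0" for e :: real
    proof -
      have "v - e *\<^sub>R z \<in> V" using v zV V(1) by (simp add: subspace_diff subspace_scale)
      from gain[OF this] have "(s * norm (v - e *\<^sub>R z))\<^sup>2 \<le> (norm (M *v (v - e *\<^sub>R z)))\<^sup>2"
        by (rule power_mono) (simp add: s_def)
      moreover have "(norm (v - e *\<^sub>R z))\<^sup>2 = 1 - 2 * e * (v \<bullet> z) + e\<^sup>2 * (norm z)\<^sup>2"
        using vv unfolding power2_norm_eq_inner
        by (simp add: inner_diff_left inner_diff_right inner_commute power2_eq_square algebra_simps)
      moreover have "(norm (M *v (v - e *\<^sub>R z)))\<^sup>2
          = s\<^sup>2 - 2 * e * ((M *v v) \<bullet> (M *v z)) + e\<^sup>2 * (norm (M *v z))\<^sup>2"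
        unfolding s_def power2_norm_eq_inner
        by (simp add: matrix_vector_mult_diff_distrib matrix_vector_mult_scaleR
          inner_diff_left inner_diff_right inner_commute power2_eq_square algebra_simps)
      ultimately have "0 \<le> e\<^sup>2 * q - 2 * e * ((M *v v) \<bullet> (M *v z) - s\<^sup>2 * (v \<bullet> z))"
        by (simp add: q_def power_mult_distrib algebra_simps)
      then have "0 \<le> e * (e * q - 2 * c)" unfolding zz by (simp add: power2_eq_square algebra_simps)
      then show ?thesis using that by (simp add: zero_le_mult_iff)
    qed
    \<comment> \<open>this step length gives \<open>e q \<le> c < 2 c\<close>\<close>
    have "c / (1 + \<bar>q\<bar>) * q \<le> c / (1 + \<bar>q\<bar>) * (1 + \<bar>q\<bar>)"
      by (rule mult_left_mono) (use c in auto)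
    also have "\<dots> = c" by (simp add: add_nonneg_eq_0_iff)
    finally show False using key[of "c / (1 + \<bar>q\<bar>)"] c by (simp add: add_pos_nonneg)
  qed
  then have "(transpose M ** M) *v v = s\<^sup>2 *\<^sub>R v" by (simp add: z_def)
  moreover have "v \<noteq> 0" using v by auto
  ultimately show thesis using that[of v s] gain v by (auto simp: s_def)
qed

definition gram_eigenspace :: "real^'c^'r \<Rightarrow> real \<Rightarrow> (real^'c) set" where
  "gram_eigenspace M s = {v. (transpose M ** M) *v v = s\<^sup>2 *\<^sub>R v}"

lemma singular_value_mult_pos_iff:
  "singular_value_mult M s > 0 \<longleftrightarrow> 0 \<le> s \<and> (\<exists>v. v \<noteq> 0 \<and> v \<in> gram_eigenspace M s)"
  by (auto simp: singular_value_mult_def gram_eigenspace_def[symmetric] simp flip: neq0_conv)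

lemma gram_eigenspaces_orthogonal:
  assumes "v \<in> gram_eigenspace M s" "w \<in> gram_eigenspace M s'" "0 \<le> s" "0 \<le> s'" "s \<noteq> s'"
  shows "v \<bullet> w = 0"
proof -
  have "s\<^sup>2 * (v \<bullet> w) = (M *v v) \<bullet> (M *v w)"
    using assms(1) inner_gram[of M v w] by (simp add: gram_eigenspace_def)
  also have "\<dots> = s'\<^sup>2 * (v \<bullet> w)"
    using assms(2) inner_gram[of M w v] by (simp add: gram_eigenspace_def inner_commute)
  finally show ?thesis using assms(3-5) by simp
qed

lemma dim_gram_eigenspaces:
  assumes "finite F" "\<And>s. s \<in> F \<Longrightarrow> 0 \<le> s"
  shows "dim (\<Union>s\<in>F. gram_eigenspace M s) = (\<Sum>s\<in>F. singular_value_mult M s)"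
  using assms
proof (induction F)
  case (insert s F)
  have "dim (gram_eigenspace M s \<union> (\<Union>s\<in>F. gram_eigenspace M s))
      = dim (gram_eigenspace M s) + dim (\<Union>s\<in>F. gram_eigenspace M s)"
    by (rule dim_orthogonal_sum) (use insert gram_eigenspaces_orthogonal in blast)
  with insert show ?case by (simp add: singular_value_mult_def gram_eigenspace_def)
qed simp

lemma finite_singular_values:
  fixes M :: "real^'c^'r"
  shows "finite {s. singular_value_mult M s > 0}"
proof (rule conjunct1[OF finite_if_finite_subsets_card_bdd[where C = "CARD('c)"]])
  fix F assume F: "F \<subseteq> {s. singular_value_mult M s > 0}" "finite F"
  have "card F \<le> (\<Sum>s\<in>F. singular_value_mult M s)"
    using sum_mono[of F "\<lambda>_. 1" "singular_value_mult M"] F by (force simp: Suc_le_eq)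
  also have "\<dots> = dim (\<Union>s\<in>F. gram_eigenspace M s)"
    using F by (intro dim_gram_eigenspaces[symmetric]) (auto simp: singular_value_mult_pos_iff)
  also have "\<dots> \<le> CARD('c)" by (rule dim_subset_UNIV_cart)
  finally show "card F \<le> CARD('c)" .
qed

text \<open>
  This is the spectral theorem for \<open>M\<^sup>T M\<close> in terms of dimensions. The orthogonal complement of
  the sum of the eigenspaces is invariant; if it were nonzero it would contain a further eigenvector.
  It guarantees that the list of singular values has an entry at position \<open>CARD('c)\<close>.
\<close>

lemma sum_singular_value_mult:
  fixes M :: "real^'c^'r"
  shows "(\<Sum>s | singular_value_mult M s > 0. singular_value_mult M s) = CARD('c)"
proof -
  let ?S = "{s. singular_value_mult M s > 0}" and ?T = "transpose M ** M"
  let ?U = "\<Union>s\<in>?S. gram_eigenspace M s"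
  define V where "V = {v. \<forall>u\<in>?U. v \<bullet> u = 0}"
  have "subspace V" by (auto simp: V_def subspace_def inner_add_left)
  have inv: "?T *v v \<in> V" if "v \<in> V" for v
  proof -
    have "(?T *v v) \<bullet> u = 0" if u: "u \<in> ?U" for u
    proof -
      obtain s where "?T *v u = s\<^sup>2 *\<^sub>R u" using u by (auto simp: gram_eigenspace_def)
      moreover have "v \<bullet> u = 0" using \<open>v \<in> V\<close> u unfolding V_def by blast
      ultimately show ?thesis using inner_gram[of M u v] inner_gram[of M v u]
        by (simp add: inner_commute)
    qed
    then show ?thesis unfolding V_def by blast
  qed
  have V0: "V = {0}"
  proof (rule ccontr)
    assume "V \<noteq> {0}"
    then obtain v s where "v \<in> V" "v \<noteq> 0" "0 \<le> s" "?T *v v = s\<^sup>2 *\<^sub>R v"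
      by (rule minimal_gain_eigenvector[OF \<open>subspace V\<close> _ inv])
    then have "v \<in> ?U" by (auto simp: singular_value_mult_pos_iff gram_eigenspace_def)
    with \<open>v \<in> V\<close> have "v \<bullet> v = 0" unfolding V_def by blast
    with \<open>v \<noteq> 0\<close> show False by simp
  qed
  have "dim ?U = CARD('c)"
  proof (rule ccontr)
    assume "dim ?U \<noteq> CARD('c)"
    then have "dim ?U < DIM(real^'c)" using dim_subset_UNIV_cart[of ?U] by simp
    then obtain v where v: "v \<noteq> 0" "\<And>u. u \<in> span ?U \<Longrightarrow> orthogonal v u"
      by (rule orthogonal_to_subspace_exists) blast
    have "v \<in> V" unfolding V_def mem_Collect_eq
    proof
      show "v \<bullet> u = 0" if "u \<in> ?U" for u
        using v(2)[OF span_base[OF that]] by (simp only: orthogonal_def)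
    qed
    with V0 v(1) show False by blast
  qed
  then show ?thesis
    using dim_gram_eigenspaces[OF finite_singular_values[of M], of M]
    by (simp add: singular_value_mult_pos_iff)
qed

lemma last_singular_value:
  fixes M :: "real^'c^'r"
  shows "singular_value CARD('c) M = Min {s. singular_value_mult M s > 0}"
proof -
  let ?S = "{s. singular_value_mult M s > 0}"
  define X where "X = (\<Sum>s\<in>?S. replicate_mset (singular_value_mult M s) s)"
  let ?l = "sorted_list_of_multiset X"
  have setX: "set_mset X = ?S"
    unfolding X_def using finite_singular_values[of M] by (auto simp: set_mset_sum in_replicate_mset split: if_splits)
  have len: "length ?l = CARD('c)"
    using sum_singular_value_mult[of M] by (simp add: X_def size_multiset_sum flip: size_mset)
  have ne: "?l \<noteq> []" using len by force
  have "singular_value CARD('c) M = ?l ! 0"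
    using len by (simp add: singular_value_def singular_values_def X_def[symmetric] rev_nth)
  also have "\<dots> = Min (set ?l)"
  proof -
    obtain a l where l: "?l = a # l" using ne by (cases ?l) auto
    with sorted_sorted_list_of_multiset[of X] have "\<forall>b\<in>set l. a \<le> b" by simp
    then have "Min (set (a # l)) = a" by (intro Min_eqI) auto
    with l show ?thesis by (simp only: nth_Cons_0)
  qed
  finally show ?thesis by (simp add: setX)
qed

text \<open>
  Positions in a sorted list become extremal properties, in which form the genericity condition
  compares two minimal gains.
\<close>

lemma last_singular_value_minimal_gain:
  fixes M :: "real^'c^'r"
  shows "0 \<le> singular_value CARD('c) M"
    and "singular_value CARD('c) M * norm v \<le> norm (M *v v)"
    and "\<exists>v. v \<noteq> 0 \<and> (transpose M ** M) *v v = (singular_value CARD('c) M)\<^sup>2 *\<^sub>R v"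
proof -
  let ?S = "{s. singular_value_mult M s > 0}"
  have ne: "(UNIV :: (real^'c) set) \<noteq> {0}"
  proof -
    have "axis undefined 1 \<noteq> (0 :: real^'c)" by (simp add: axis_eq_0_iff)
    then show ?thesis by blast
  qed
  obtain u s where u: "u \<noteq> 0" "0 \<le> s" "(transpose M ** M) *v u = s\<^sup>2 *\<^sub>R u"
    and gain: "\<And>w. s * norm w \<le> norm (M *v w)"
    by (rule minimal_gain_eigenvector[OF subspace_UNIV ne, of M]) auto
  have "Min ?S = s"
  proof (rule Min_eqI)
    show "finite ?S" by (rule finite_singular_values)
    show "s \<in> ?S" using u by (auto simp: singular_value_mult_pos_iff gram_eigenspace_def)
    fix s' assume "s' \<in> ?S"
    then obtain v where v: "0 \<le> s'" "v \<noteq> 0" "(transpose M ** M) *v v = s'\<^sup>2 *\<^sub>R v"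
      by (auto simp: singular_value_mult_pos_iff gram_eigenspace_def)
    have "(s * norm v)\<^sup>2 \<le> (norm (M *v v))\<^sup>2" using gain u by (intro power_mono) auto
    also have "\<dots> = (s' * norm v)\<^sup>2"
      unfolding power_mult_distrib power2_norm_eq_inner inner_gram[symmetric] v(3) by simp
    finally have "s * norm v \<le> s' * norm v" by (rule power2_le_imp_le) (use v(1) in simp)
    with v show "s \<le> s'" by simp
  qed
  then have "singular_value CARD('c) M = s" by (simp only: last_singular_value)
  note sv = this
  show "0 \<le> singular_value CARD('c) M" unfolding sv by (rule u(2))
  show "singular_value CARD('c) M * norm v \<le> norm (M *v v)" unfolding sv by (rule gain)
  show "\<exists>v. v \<noteq> 0 \<and> (transpose M ** M) *v v = (singular_value CARD('c) M)\<^sup>2 *\<^sub>R v"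
    unfolding sv by (intro exI[of _ u] conjI u(1) u(3))
qed

section \<open>Pseudoinverses of matrices with full row rank\<close>

lemma matrix_inv_injective:
  fixes S :: "real^'n^'n"
  assumes "\<And>v. S *v v = 0 \<Longrightarrow> v = 0"
  shows "S ** matrix_inv S = mat 1" "matrix_inv S ** S = mat 1"
proof -
  have "invertible S"
    using assms by (simp add: invertible_left_inverse matrix_left_invertible_ker)
  then have "\<exists>T. S ** T = mat 1 \<and> T ** S = mat 1" by (simp add: invertible_def)
  from someI_ex[OF this] show "S ** matrix_inv S = mat 1" "matrix_inv S ** S = mat 1"
    by (simp_all add: matrix_inv_def)
qed

text \<open>
  For full row rank, \<open>Y = X\<^sup>T (X X\<^sup>T)\<^sup>-\<^sup>1\<close> is a right inverse with the four Penrose properties. Any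
  other such \<open>Z\<close> is also a right inverse, so that \<open>Y X\<close> and \<open>Z X\<close> are symmetric and each absorbs
  the other on one side; hence they are equal.
\<close>

lemma pinv_full_row_rank:
  fixes X :: "real^'c^'r"
  assumes "rank X = CARD('r)"
  shows "X ** pinv X = mat 1" and "transpose (pinv X ** X) = pinv X ** X"
proof -
  let ?G = "X ** transpose X"
  have G: "?G ** matrix_inv ?G = mat 1"
  proof (rule matrix_inv_injective)
    fix u assume "?G *v u = 0"
    then have "(u v* X) \<bullet> (u v* X) = 0"
      by (simp add: dot_lmul_matrix matrix_vector_mul_assoc[symmetric])
    then have "transpose X *v u = 0" by simp
    moreover have "inj ((*v) (transpose X))"
      using assms full_rank_injective[of "transpose X"] by (simp add: rank_transpose)
    ultimately show "u = 0" by (metis injD matrix_vector_mult_0_right)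
  qed
  define Y where "Y = transpose X ** matrix_inv ?G"
  have XY: "X ** Y = mat 1"
    using G by (simp add: Y_def matrix_mul_assoc)
  have sym_inv: "transpose (matrix_inv ?G) = matrix_inv ?G"
  proof -
    have "transpose (matrix_inv ?G) ** ?G = mat 1"
      using arg_cong[OF G, of transpose] by (simp add: matrix_transpose_mul)
    then have "transpose (matrix_inv ?G) ** ?G ** matrix_inv ?G = matrix_inv ?G" by simp
    then show ?thesis
      using G by (simp add: matrix_mul_assoc[symmetric])
  qed
  have YX: "transpose (Y ** X) = Y ** X"
    by (simp add: Y_def matrix_transpose_mul sym_inv matrix_mul_assoc)
  have "pinv X = Y"
    unfolding pinv_def
  proof (rule the_equality)
    show "X ** Y ** X = X \<and> Y ** X ** Y = Y \<and> transpose (X ** Y) = X ** Y \<and> transpose (Y ** X) = Y ** X"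
      using XY YX by (simp add: matrix_mul_assoc[symmetric])
  next
    fix Z assume Z: "X ** Z ** X = X \<and> Z ** X ** Z = Z \<and> transpose (X ** Z) = X ** Z \<and> transpose (Z ** X) = Z ** X"
    have "(X ** Z ** X) ** Y = X ** Y" using Z by simp
    then have XZ: "X ** Z = mat 1" by (simp add: matrix_mul_assoc[symmetric] XY)
    have "Y ** X = (Y ** X) ** (Z ** X)"
      using XZ by (metis matrix_mul_assoc matrix_mul_rid)
    then have "transpose (Y ** X) = transpose ((Y ** X) ** (Z ** X))" by simp
    also have "\<dots> = (Z ** X) ** (Y ** X)" using YX Z by (simp only: matrix_transpose_mul)
    also have "\<dots> = Z ** X" using XY by (metis matrix_mul_assoc matrix_mul_rid)
    finally have "Y ** X = Z ** X" using YX by simp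
    then have "Z ** X ** Z = Y ** (X ** Z)" by (simp add: matrix_mul_assoc)
    then show "Z = Y" using Z XZ by simp
  qed
  with XY YX show "X ** pinv X = mat 1" "transpose (pinv X ** X) = pinv X ** X" by simp_all
qed

lemma pinv_kernel:
  fixes X :: "real^'c^'r"
  assumes "rank X = CARD('r)" "X *v w = 0"
  shows "w v* pinv X = 0"
proof -
  have "w v* pinv X = w v* (transpose (pinv X ** X) ** pinv X)"
    using pinv_full_row_rank[OF assms(1)] by (simp add: matrix_mul_assoc[symmetric])
  also have "\<dots> = ((X *v w) v* transpose (pinv X)) v* pinv X"
    by (simp add: matrix_transpose_mul vector_matrix_mul_assoc[symmetric])
  finally show ?thesis using assms(2) by simp
qed

text \<open>
  Since \<open>pinv X ** X\<close> is symmetric, the range of the pseudoinverse is contained in the row space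
  of \<open>X\<close>; the right-hand side exhibits the coefficients.
\<close>

lemma pinv_range:
  fixes X :: "real^'c^'r"
  assumes "rank X = CARD('r)"
  shows "pinv X *v u = ((u v* transpose (pinv X)) v* pinv X) v* X"
proof -
  have "pinv X *v u = (transpose (pinv X ** X) ** pinv X) *v u"
    using pinv_full_row_rank[OF assms] by (simp add: matrix_mul_assoc[symmetric])
  then show ?thesis
    by (simp add: matrix_transpose_mul matrix_vector_mul_assoc[symmetric])
qed

lemma rank_augment:
  fixes C :: "real^'n^'p"
  assumes "rank C = CARD('p)"
  shows "rank (augment C d) = CARD('p)"
proof -
  have "inj ((*v) (transpose C))"
    using assms full_rank_injective[of "transpose C"] by (simp add: rank_transpose)
  then have C: "u v* C = 0 \<Longrightarrow> u = 0" for u by (simp add: vec.inj_iff_eq_0)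
  have "inj ((*v) (transpose (augment C d)))"
    unfolding vec.inj_iff_eq_0
  proof (intro allI impI)
    fix u assume "transpose (augment C d) *v u = 0"
    then have "u v* C = 0"
      by (simp add: vec_eq_Plus_iff) (simp add: vec_eq_iff vector_matrix_mult_def augment_def hcat_def)
    then show "u = 0" by (rule C)
  qed
  then show ?thesis
    using full_rank_injective[of "transpose (augment C d)"] by (simp add: rank_transpose)
qed

section \<open>TLSE solutions minimise a ratio\<close>

definition outer :: "real^'m \<Rightarrow> real^'n \<Rightarrow> real^'n^'m" where
  "outer u v = (\<chi> i. u $ i *\<^sub>R v)"

lemma norm_outer: "norm (outer u v) = norm u * norm v"
  by (simp add: outer_def norm_vec_def[of "\<chi> i. _ i"] L2_set_left_distrib norm_vec_def[of u])

lemma outer_mult: "outer u v *v w = (v \<bullet> w) *\<^sub>R u"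
  by (simp add: vec_eq_iff matrix_vector_mul_component outer_def)

text \<open>
  Feasibility means \<open>A x - b = f - E x\<close>, and the right-hand side is \<open>[E f]\<close> applied to \<open>(- x, 1)\<close>.
\<close>

lemma tlse_residual_le:
  assumes "tlse_feasible A b C d E f x"
  shows "norm (A *v x - b) \<le> norm (augment E f) * sqrt (1 + (norm x)\<^sup>2)"
proof -
  have "A *v x - b = f - E *v x"
    using assms by (simp add: tlse_feasible_def matrix_vector_mult_add_rdistrib algebra_simps)
  then have "norm (A *v x - b) \<le> norm f + norm (E *v x)"
    by (simp add: norm_triangle_ineq4)
  also have "\<dots> \<le> norm f + norm E * norm x" by (simp add: norm_matrix_vector_le)
  also have "\<dots> = (norm E, norm f) \<bullet> (norm x, 1)" by simp
  also have "\<dots> \<le> norm (norm E, norm f) * norm (norm x, 1 :: real)" by (rule norm_cauchy_schwarz)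
  also have "\<dots> = norm (augment E f) * sqrt (1 + (norm x)\<^sup>2)"
    by (simp add: norm_augment norm_Pair add.commute)
  finally show ?thesis .
qed

text \<open>
  Equality in the Cauchy--Schwarz bound requires \<open>[E f]\<close> to have rank one with rows proportional
  to \<open>(- x, 1)\<close>.
\<close>

lemma tlse_residual_attained:
  assumes "C *v x = d"
  obtains E f where "tlse_feasible A b C d E f x"
    and "norm (augment E f) * sqrt (1 + (norm x)\<^sup>2) = norm (A *v x - b)"
proof -
  define r where "r = A *v x - b"
  define c where "c = 1 + (norm x)\<^sup>2"
  have c: "c > 0" by (simp add: c_def add_pos_nonneg)
  define E where "E = outer (- (1 / c) *\<^sub>R r) x"
  define f where "f = (1 / c) *\<^sub>R r"
  have "E *v x = - ((norm x)\<^sup>2 / c) *\<^sub>R r"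
    by (simp add: E_def outer_mult power2_norm_eq_inner)
  then have "f - E *v x = ((1 + (norm x)\<^sup>2) / c) *\<^sub>R r"
    by (simp add: f_def scaleR_add_left add_divide_distrib)
  then have "f - E *v x = r" using c by (simp add: c_def)
  then have "tlse_feasible A b C d E f x"
    using assms by (auto simp: tlse_feasible_def matrix_vector_mult_add_rdistrib r_def algebra_simps)
  moreover have "norm (augment E f) * sqrt c = norm r"
  proof -
    have "(norm (augment E f))\<^sup>2 = (norm r)\<^sup>2 * ((norm x)\<^sup>2 + 1) / c\<^sup>2"
      using c by (simp add: norm_augment norm_Pair E_def f_def norm_outer power_mult_distrib
          power_divide add_divide_distrib algebra_simps)
    then have "(norm (augment E f))\<^sup>2 = (norm r)\<^sup>2 * c / c\<^sup>2"
      by (simp only: c_def add.commute)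
    then have "(norm (augment E f) * sqrt c)\<^sup>2 = (norm r)\<^sup>2 * c / c\<^sup>2 * c"
      by (simp only: power_mult_distrib real_sqrt_pow2[OF less_imp_le[OF c]])
    then have "(norm (augment E f) * sqrt c)\<^sup>2 = (norm r)\<^sup>2"
      using c by (simp add: power2_eq_square[of c])
    then show ?thesis using c by (simp add: power2_eq_iff_nonneg)
  qed
  ultimately show thesis using that by (simp add: c_def r_def)
qed

lemma tlse_solution_iff_minimizes_ratio:
  "tlse_solution A b C d x \<longleftrightarrow> C *v x = d \<and>
     (\<forall>y. C *v y = d \<longrightarrow>
        norm (A *v x - b) / sqrt (1 + (norm x)\<^sup>2) \<le> norm (A *v y - b) / sqrt (1 + (norm y)\<^sup>2))"
  (is "_ \<longleftrightarrow> _ \<and> (\<forall>y. _ \<longrightarrow> ?g x \<le> ?g y)")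
proof -
  have pos: "sqrt (1 + (norm y)\<^sup>2) > 0" for y :: "real^'a"
    by (simp add: add_pos_nonneg)
  have lower: "?g y \<le> norm (augment E f)" if "tlse_feasible A b C d E f y" for E f y
    using tlse_residual_le[OF that] pos[of y] by (simp add: pos_divide_le_eq)
  have attained: "\<exists>E f. tlse_feasible A b C d E f y \<and> norm (augment E f) = ?g y"
    if y: "C *v y = d" for y
  proof -
    obtain E f where "tlse_feasible A b C d E f y"
      and "norm (augment E f) * sqrt (1 + (norm y)\<^sup>2) = norm (A *v y - b)"
      using tlse_residual_attained[OF y] by blast
    moreover from this(2) have "norm (augment E f) = ?g y"
      using pos[of y] by (simp add: eq_divide_eq)
    ultimately show ?thesis by blast
  qed
  show ?thesis
  proof
    assume "tlse_solution A b C d x"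
    then obtain E f where Ef: "tlse_feasible A b C d E f x"
      and opt: "\<And>E' f' x'. tlse_feasible A b C d E' f' x' \<Longrightarrow> norm (augment E f) \<le> norm (augment E' f')"
      unfolding tlse_solution_def by blast
    have "?g x \<le> ?g y" if y: "C *v y = d" for y
    proof -
      obtain E' f' where E': "tlse_feasible A b C d E' f' y" "norm (augment E' f') = ?g y"
        using attained[OF y] by blast
      show ?thesis using order_trans[OF lower[OF Ef] opt[OF E'(1)]] unfolding E'(2) .
    qed
    moreover have "C *v x = d" using Ef by (simp add: tlse_feasible_def)
    ultimately show "C *v x = d \<and> (\<forall>y. C *v y = d \<longrightarrow> ?g x \<le> ?g y)" by blast
  next
    assume R: "C *v x = d \<and> (\<forall>y. C *v y = d \<longrightarrow> ?g x \<le> ?g y)"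
    obtain E f where Ef: "tlse_feasible A b C d E f x" "norm (augment E f) = ?g x"
      using attained R by blast
    have "?g x \<le> norm (augment E' f')" if "tlse_feasible A b C d E' f' x'" for E' f' x'
    proof -
      have "C *v x' = d" using that by (simp add: tlse_feasible_def)
      then have "?g x \<le> ?g x'" using R by blast
      then show ?thesis using lower[OF that] by (rule order_trans)
    qed
    then show "tlse_solution A b C d x"
      unfolding tlse_solution_def Ef(2)[symmetric] using Ef(1) by blast
  qed
qed

text \<open>
  For \<open>y = x + v\<close> with \<open>C v = 0\<close>, stationarity removes the term linear in \<open>v\<close>, so that
  \<open>|A y - b|\<^sup>2 - s (1 + |y|\<^sup>2) = |A v|\<^sup>2 - s |v|\<^sup>2\<close>. Positivity of this difference says that the
  squared ratio at \<open>y\<close> exceeds its value \<open>s\<close> at \<open>x\<close>.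
\<close>

lemma tlse_solution_iff_stationary:
  fixes A :: "real^'n^'q" and C :: "real^'n^'p"
  assumes Cx: "C *v x = d"
    and stationary: "\<And>v. C *v v = 0 \<Longrightarrow> ((A *v x - b) v* A - s *\<^sub>R x) \<bullet> v = 0"
    and optval: "(norm (A *v x - b))\<^sup>2 = s * (1 + (norm x)\<^sup>2)"
    and pos: "\<And>v. v \<noteq> 0 \<Longrightarrow> C *v v = 0 \<Longrightarrow> s * (norm v)\<^sup>2 < (norm (A *v v))\<^sup>2"
  shows "tlse_solution A b C d y \<longleftrightarrow> y = x"
proof -
  let ?c = "\<lambda>y :: real^'n. 1 + (norm y)\<^sup>2"
  let ?g = "\<lambda>y. norm (A *v y - b) / sqrt (?c y)"
  have c: "?c y > 0" for y by (simp add: add_pos_nonneg)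
  have g2: "(?g y)\<^sup>2 = (norm (A *v y - b))\<^sup>2 / ?c y" for y
    using c[of y] by (simp add: power_divide)
  have gx: "(?g x)\<^sup>2 = s" using c[of x] unfolding g2 optval by simp
  have less: "?g x < ?g y" if y: "C *v y = d" "y \<noteq> x" for y
  proof -
    define v where "v = y - x"
    have yv: "y = x + v" and v: "v \<noteq> 0" "C *v v = 0"
      using y Cx by (auto simp: v_def matrix_vector_mult_diff_distrib)
    define r where "r = A *v x - b"
    have "(norm (A *v y - b))\<^sup>2 = (norm (r + A *v v))\<^sup>2"
      by (simp add: yv r_def matrix_vector_right_distrib algebra_simps)
    also have "\<dots> = (norm r)\<^sup>2 + 2 * (r \<bullet> (A *v v)) + (norm (A *v v))\<^sup>2"
      by (simp add: power2_norm_eq_inner inner_add_left inner_add_right inner_commute)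
    also have "r \<bullet> (A *v v) = s * (x \<bullet> v)"
      using stationary[OF v(2)] by (simp add: r_def dot_lmul_matrix inner_diff_left)
    also have "(norm r)\<^sup>2 + 2 * (s * (x \<bullet> v)) + (norm (A *v v))\<^sup>2 > s * ?c y"
    proof -
      have "s * ?c y = s * ?c x + 2 * (s * (x \<bullet> v)) + s * (norm v)\<^sup>2"
        by (simp add: yv power2_norm_eq_inner inner_add_left inner_add_right inner_commute algebra_simps)
      then show ?thesis using optval pos[OF v] by (simp add: r_def)
    qed
    finally have "s < (?g y)\<^sup>2"
      using c[of y] by (simp add: g2 pos_less_divide_eq)
    then have "(?g x)\<^sup>2 < (?g y)\<^sup>2" by (simp only: gx)
    then show ?thesis by (rule power2_less_imp_less) simp
  qed
  show ?thesis
    unfolding tlse_solution_iff_minimizes_ratio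
  proof
    assume "C *v y = d \<and> (\<forall>z. C *v z = d \<longrightarrow> ?g y \<le> ?g z)"
    then have "C *v y = d" "?g y \<le> ?g x" using Cx by blast+
    then show "y = x" using less[of y] leD by blast
  next
    assume yx: "y = x"
    have "?g x \<le> ?g z" if "C *v z = d" for z
    proof (cases "z = x")
      case False
      show ?thesis using less[OF that False] by (rule less_imp_le)
    qed simp
    then show "C *v y = d \<and> (\<forall>z. C *v z = d \<longrightarrow> ?g y \<le> ?g z)"
      using Cx unfolding yx by blast
  qed
qed

section \<open>Critical points of the TLSE problem\<close>

text \<open>
  The Lagrange conditions for the ratio. The lower part of \<open>t\<close> is the residual \<open>A x - b\<close>, the upper
  part is the negated multiplier \<open>\<lambda>\<close> of \<open>C x = d\<close>, and \<open>A\<^sup>T r - \<sigma>\<^sup>2 x = C\<^sup>T \<lambda>\<close>. The number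
  \<open>\<sigma>\<^sup>2\<close> is written as \<open>- (h \<bullet> t)\<close>, which makes the system square and polynomial in \<open>(x, t)\<close>.
\<close>

definition tlse_critical ::
  "real^'n^('p::finite + 'q::finite) \<Rightarrow> real^('p + 'q) \<Rightarrow> real^'n \<Rightarrow> real^('p + 'q) \<Rightarrow> bool" where
  "tlse_critical L h x t \<longleftrightarrow>
     t v* L + (h \<bullet> t) *\<^sub>R x = 0 \<and> L *v x - h = vappend 0 (lower_rows t)"

text \<open>
  Pairing the stationarity equation with \<open>x\<close> shows that \<open>- (h \<bullet> t)\<close> is the squared ratio at \<open>x\<close>.
\<close>

lemma tlse_critical_norm:
  assumes "tlse_critical L h x t"
  shows "(norm (lower_rows t))\<^sup>2 = - (h \<bullet> t) * (1 + (norm x)\<^sup>2)"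
proof -
  have "0 = (t v* L + (h \<bullet> t) *\<^sub>R x) \<bullet> x"
    using assms by (simp add: tlse_critical_def)
  also have "\<dots> = t \<bullet> (h + vappend 0 (lower_rows t)) + (h \<bullet> t) * (x \<bullet> x)"
  proof -
    have "L *v x = h + vappend 0 (lower_rows t)"
      using assms by (simp add: tlse_critical_def algebra_simps)
    then show ?thesis by (simp add: inner_add_left dot_lmul_matrix)
  qed
  also have "\<dots> = h \<bullet> t + (norm (lower_rows t))\<^sup>2 + (h \<bullet> t) * (norm x)\<^sup>2"
    by (simp add: inner_add_right inner_commute inner_Plus[of t "vappend _ _"] power2_norm_eq_inner)
  finally show ?thesis by (simp add: algebra_simps)
qed

lemma tlse_critical_unique_solution:
  assumes crit: "tlse_critical L h x t"
    and pos: "\<And>v. v \<noteq> 0 \<Longrightarrow> upper_rows L *v v = 0 \<Longrightarrow>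
       - (h \<bullet> t) * (norm v)\<^sup>2 < (norm (lower_rows L *v v))\<^sup>2"
  shows "tlse_solution_data L h y \<longleftrightarrow> y = x"
proof -
  have Lx: "L *v x - h = vappend 0 (lower_rows t)" using crit by (simp add: tlse_critical_def)
  have up: "upper_rows L *v x = upper_rows h"
    using arg_cong[OF Lx, of upper_rows] by (simp add: rows_matrix_vector_mult)
  have low: "lower_rows L *v x - lower_rows h = lower_rows t"
    using arg_cong[OF Lx, of lower_rows] by (simp add: rows_matrix_vector_mult)
  show ?thesis unfolding tlse_solution_data_def
  proof (rule tlse_solution_iff_stationary[OF up, where s = "- (h \<bullet> t)"], unfold low)
    fix v assume v: "upper_rows L *v v = 0"
    have "upper_rows t v* upper_rows L + lower_rows t v* lower_rows L + (h \<bullet> t) *\<^sub>R x = 0"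
      using crit by (simp add: tlse_critical_def rows_vector_matrix_mult[of t])
    then have "lower_rows t v* lower_rows L - - (h \<bullet> t) *\<^sub>R x = - (upper_rows t v* upper_rows L)"
      by (simp add: eq_neg_iff_add_eq_0 ac_simps)
    then show "(lower_rows t v* lower_rows L - - (h \<bullet> t) *\<^sub>R x) \<bullet> v = 0"
      using v by (simp add: dot_lmul_matrix)
  next
    show "(norm (lower_rows t))\<^sup>2 = - (h \<bullet> t) * (1 + (norm x)\<^sup>2)"
      using crit by (rule tlse_critical_norm)
  qed (rule pos)
qed

text \<open>
  The vector \<open>w = (x, - 1)\<close> satisfies \<open>[C d] w = 0\<close>, and the stationarity equation together with
  \<open>h \<bullet> t = - s\<close> reads \<open>[A b]\<^sup>T r = s w + [C d]\<^sup>T \<lambda>\<close>. The transposed pseudoinverse of \<open>[C d]\<close>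
  annihilates \<open>w\<close> and turns the last term into \<open>\<lambda>\<close>.
\<close>

lemma tlse_multiplier_pinv:
  fixes A :: "real^'n^'q" and C :: "real^'n^'p"
  assumes crit: "tlse_critical (vcat C A) (vappend d b) x t"
    and rank: "rank C = CARD('p)"
  shows "t = vappend (- (lower_rows t v* (augment A b ** pinv (augment C d)))) (lower_rows t)"
proof -
  let ?r = "lower_rows t" and ?l = "- upper_rows t" and ?h = "vappend d b"
  define s where "s = - (?h \<bullet> t)"
  define w :: "real^('n + 1)" where "w = vappend x (\<chi> _. - 1)"
  have "?r v* A - s *\<^sub>R x = ?l v* C"
  proof -
    have "upper_rows t v* C + ?r v* A + (?h \<bullet> t) *\<^sub>R x = 0"
      using crit by (simp add: tlse_critical_def rows_vector_matrix_mult[of t])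
    then show ?thesis by (simp add: s_def uminus_vector_matrix_mult eq_neg_iff_add_eq_0 ac_simps)
  qed
  moreover have "?r \<bullet> b + s = ?l \<bullet> d"
    by (simp add: s_def inner_Plus[of ?h] inner_commute[of ?r b] inner_commute[of "upper_rows t" d])
  ultimately have "?r v* augment A b = s *\<^sub>R w + ?l v* augment C d"
    by (simp add: vector_augment w_def vappend_scaleR vappend_add vec_eq_Plus_iff[of "vappend _ _"]
        vec_eq_iff[of "vappend _ _"] algebra_simps)
  then have "?r v* (augment A b ** pinv (augment C d))
      = s *\<^sub>R (w v* pinv (augment C d)) + ?l v* (augment C d ** pinv (augment C d))"
    by (simp only: vector_matrix_mul_assoc[symmetric] vector_matrix_left_distrib scaleR_vector_matrix_assoc)
  also have "w v* pinv (augment C d) = 0"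
  proof (rule pinv_kernel[OF rank_augment[OF rank]])
    have "C *v x = d"
      using arg_cong[of _ _ upper_rows, OF conjunct2[OF crit[unfolded tlse_critical_def]]]
      by (simp add: rows_matrix_vector_mult)
    then show "augment C d *v w = 0" by (simp add: augment_vector w_def)
  qed
  finally show ?thesis
    by (simp add: pinv_full_row_rank[OF rank_augment[OF rank]])
qed

section \<open>Zeros of a perturbed linear equation\<close>

text \<open>
  The map \<open>\<delta> \<mapsto> - J\<^sup>-\<^sup>1 (B \<Delta> + R \<delta> \<Delta>)\<close> sends a ball of radius proportional to \<open>|\<Delta>|\<close> into
  itself if \<open>\<Delta>\<close> is small, because \<open>R\<close> is quadratically small there. A fixed point is a zero, and
  it differs from \<open>g = - J\<^sup>-\<^sup>1 B \<Delta>\<close> by \<open>J\<^sup>-\<^sup>1 (R \<delta> \<Delta>)\<close>.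
\<close>

lemma perturbed_zero_to_second_order:
  fixes J :: "'u::euclidean_space \<Rightarrow> 'u" and B :: "'d::real_normed_vector \<Rightarrow> 'u"
  assumes J: "linear J" "inj J" and B: "bounded_linear B"
    and cont: "\<And>\<Delta>. continuous_on UNIV (\<lambda>\<delta>. R \<delta> \<Delta>)"
    and R: "\<And>\<delta> \<Delta>. norm \<delta> \<le> 1 \<Longrightarrow> norm \<Delta> \<le> 1 \<Longrightarrow> norm (R \<delta> \<Delta>) \<le> M * (norm \<delta> + norm \<Delta>)\<^sup>2"
  obtains k e :: real where "0 \<le> k" "0 < e"
    "\<And>\<Delta>. norm \<Delta> < e \<Longrightarrow> \<exists>\<delta> g. J \<delta> + B \<Delta> + R \<delta> \<Delta> = 0 \<and> norm \<delta> \<le> k * norm \<Delta> \<and>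
       J g + B \<Delta> = 0 \<and> norm (\<delta> - g) \<le> k * (norm \<Delta>)\<^sup>2"
proof -
  obtain J' where J': "linear J'" and J'J: "\<And>x. J' (J x) = x" and JJ': "\<And>x. J (J' x) = x"
    using linear_injective_isomorphism[OF J] by metis
  obtain N where N: "N > 0" "\<And>x. norm (J' x) \<le> N * norm x"
    using linear_bounded_pos[OF J'] by (metis mult.commute)
  obtain K where K: "K > 0" "\<And>x. norm (B x) \<le> K * norm x"
    using bounded_linear.pos_bounded[OF B] by (metis mult.commute)
  define k1 where "k1 = N * K + 1"
  define c where "c = N * (\<bar>M\<bar> * (k1 + 1)\<^sup>2)"
  \<comment> \<open>The bounds keep both increments in the unit balls, where \<open>R\<close> is controlled,
    and make the contribution of \<open>R\<close> at most \<open>|\<Delta>|\<close>, the slack contained in \<open>k1\<close>.\<close>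
  define e where "e = min 1 (min (1 / k1) (1 / (c + 1)))"
  have k1: "k1 > 0" using N(1) K(1) by (simp add: k1_def add_pos_pos)
  have c: "c \<ge> 0" using N(1) by (simp add: c_def)
  have e: "e > 0" using k1 c by (simp add: e_def)
  have sol: "\<exists>\<delta> g. J \<delta> + B \<Delta> + R \<delta> \<Delta> = 0 \<and> norm \<delta> \<le> (k1 + c) * norm \<Delta> \<and>
       J g + B \<Delta> = 0 \<and> norm (\<delta> - g) \<le> (k1 + c) * (norm \<Delta>)\<^sup>2" if "norm \<Delta> < e" for \<Delta>
  proof -
    have \<Delta>: "norm \<Delta> \<le> 1" "k1 * norm \<Delta> \<le> 1" "c * norm \<Delta> \<le> 1"
    proof -
      show "norm \<Delta> \<le> 1" using that by (simp add: e_def)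
      show "k1 * norm \<Delta> \<le> 1"
        using that k1 by (simp add: e_def pos_less_divide_eq mult.commute)
      have "(c + 1) * norm \<Delta> < 1"
        using that c by (simp add: e_def pos_less_divide_eq mult.commute)
      then show "c * norm \<Delta> \<le> 1" by (simp add: algebra_simps) (smt (verit) norm_ge_zero)
    qed
    let ?S = "cball 0 (k1 * norm \<Delta>) :: 'u set"
    define T where "T \<delta> = - J' (B \<Delta> + R \<delta> \<Delta>)" for \<delta>
    have rem: "norm (J' (R \<delta> \<Delta>)) \<le> c * (norm \<Delta>)\<^sup>2" if "\<delta> \<in> ?S" for \<delta>
    proof -
      have \<delta>: "norm \<delta> \<le> k1 * norm \<Delta>" using that by simp
      then have "norm (R \<delta> \<Delta>) \<le> M * (norm \<delta> + norm \<Delta>)\<^sup>2" using \<Delta> by (intro R) auto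
      also have "\<dots> \<le> \<bar>M\<bar> * ((k1 + 1) * norm \<Delta>)\<^sup>2"
        using \<delta> by (intro mult_mono power_mono) (auto simp: algebra_simps)
      finally have "N * norm (R \<delta> \<Delta>) \<le> c * (norm \<Delta>)\<^sup>2"
        using N(1) by (simp add: c_def power_mult_distrib mult.assoc)
      then show ?thesis using N(2) order_trans by blast
    qed
    have "T \<in> ?S \<rightarrow> ?S"
    proof
      fix \<delta> assume "\<delta> \<in> ?S"
      have "norm (T \<delta>) \<le> norm (J' (B \<Delta>)) + norm (J' (R \<delta> \<Delta>))"
        unfolding T_def norm_minus_cancel linear_add[OF J'] by (rule norm_triangle_ineq)
      also have "norm (J' (B \<Delta>)) \<le> N * (K * norm \<Delta>)"
        using N K order_trans[OF N(2) mult_left_mono[OF K(2)]] by simp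
      also have "norm (J' (R \<delta> \<Delta>)) \<le> c * (norm \<Delta>)\<^sup>2" by (rule rem[OF \<open>\<delta> \<in> ?S\<close>])
      also have "c * (norm \<Delta>)\<^sup>2 \<le> norm \<Delta>"
        using mult_right_mono[OF \<Delta>(3), of "norm \<Delta>"] by (simp add: power2_eq_square mult.assoc)
      finally show "T \<delta> \<in> ?S" by (simp add: k1_def algebra_simps)
    qed
    moreover have "continuous_on ?S T"
      unfolding T_def
      by (intro continuous_intros linear_continuous_on_compose[OF _ J'] continuous_on_subset[OF cont]) auto
    moreover have "?S \<noteq> {}" using k1 by (simp add: not_less)
    ultimately obtain \<delta> where \<delta>: "\<delta> \<in> ?S" "T \<delta> = \<delta>"
      using brouwer[OF compact_cball convex_cball] by blast
    define g where "g = - J' (B \<Delta>)"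
    have "J g + B \<Delta> = 0" by (simp add: g_def linear_neg[OF J(1)] JJ')
    moreover have "J (T \<delta>) + (B \<Delta> + R \<delta> \<Delta>) = 0" by (simp add: T_def linear_neg[OF J(1)] JJ')
    then have "J \<delta> + B \<Delta> + R \<delta> \<Delta> = 0" by (simp add: \<delta>(2) add.assoc)
    moreover have "\<delta> - g = - J' (R \<delta> \<Delta>)"
      using \<delta>(2) by (simp add: T_def g_def linear_add[OF J'] algebra_simps)
    then have "norm (\<delta> - g) \<le> c * (norm \<Delta>)\<^sup>2" using rem[OF \<delta>(1)] by simp
    then have "norm (\<delta> - g) \<le> (k1 + c) * (norm \<Delta>)\<^sup>2"
      using k1 by (simp add: distrib_right add_increasing)
    moreover have "norm \<delta> \<le> k1 * norm \<Delta>" using \<delta>(1) by simp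
    then have "norm \<delta> \<le> (k1 + c) * norm \<Delta>"
      using c by (simp add: distrib_right add_increasing2)
    ultimately show ?thesis by blast
  qed
  have "0 \<le> k1 + c" using k1 c by simp
  from that[OF this e sol] show thesis by blast
qed

section \<open>Linearisation of the critical point equations\<close>

text \<open>
  The critical point equations split into the derivative in the unknowns \<open>(x, t)\<close>, the derivative
  in the data \<open>(L, h)\<close>, and the remaining terms of degree two and three in the increments.
\<close>

definition kkt_jacobian ::
  "real^'n^('p::finite + 'q::finite) \<Rightarrow> real^('p + 'q) \<Rightarrow> real^'n \<Rightarrow> real^('p + 'q) \<Rightarrow>
     (real^'n) \<times> (real^('p + 'q)) \<Rightarrow> (real^'n) \<times> (real^('p + 'q))" where
  "kkt_jacobian L h x t \<delta> =
     (snd \<delta> v* L + (h \<bullet> snd \<delta>) *\<^sub>R x + (h \<bullet> t) *\<^sub>R fst \<delta>,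
      L *v fst \<delta> - vappend 0 (lower_rows (snd \<delta>)))"

definition kkt_data_derivative ::
  "real^'n \<Rightarrow> real^('p::finite + 'q::finite) \<Rightarrow>
     (real^'n^('p + 'q)) \<times> (real^('p + 'q)) \<Rightarrow> (real^'n) \<times> (real^('p + 'q))" where
  "kkt_data_derivative x t \<Delta> =
     (t v* fst \<Delta> + (snd \<Delta> \<bullet> t) *\<^sub>R x, fst \<Delta> *v x - snd \<Delta>)"

definition kkt_remainder ::
  "real^('p::finite + 'q::finite) \<Rightarrow> real^'n \<Rightarrow> real^('p + 'q) \<Rightarrow> (real^'n) \<times> (real^('p + 'q)) \<Rightarrow>
     (real^'n^('p + 'q)) \<times> (real^('p + 'q)) \<Rightarrow> (real^'n) \<times> (real^('p + 'q))" where
  "kkt_remainder h x t \<delta> \<Delta> =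
     (snd \<delta> v* fst \<Delta> + (h \<bullet> snd \<delta> + snd \<Delta> \<bullet> t) *\<^sub>R fst \<delta> + (snd \<Delta> \<bullet> snd \<delta>) *\<^sub>R (x + fst \<delta>),
      fst \<Delta> *v fst \<delta>)"

lemma tlse_critical_expansion:
  assumes crit: "tlse_critical L h x t"
  shows "tlse_critical (L + fst \<Delta>) (h + snd \<Delta>) (x + fst \<delta>) (t + snd \<delta>) \<longleftrightarrow>
    kkt_jacobian L h x t \<delta> + kkt_data_derivative x t \<Delta> + kkt_remainder h x t \<delta> \<Delta> = 0"
proof -
  let ?F = "kkt_jacobian L h x t \<delta> + kkt_data_derivative x t \<Delta> + kkt_remainder h x t \<delta> \<Delta>"
  have z: "t v* L + (h \<bullet> t) *\<^sub>R x = 0" "L *v x - h - vappend 0 (lower_rows t) = 0"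
    using crit by (simp_all add: tlse_critical_def)
  have 1: "(t + snd \<delta>) v* (L + fst \<Delta>) + ((h + snd \<Delta>) \<bullet> (t + snd \<delta>)) *\<^sub>R (x + fst \<delta>)
      = (t v* L + (h \<bullet> t) *\<^sub>R x)
        + fst ?F"
    by (simp add: kkt_jacobian_def kkt_data_derivative_def kkt_remainder_def inner_add_left
        inner_add_right algebra_simps)
  have 2: "(L + fst \<Delta>) *v (x + fst \<delta>) - (h + snd \<Delta>) - vappend 0 (lower_rows (t + snd \<delta>))
      = (L *v x - h - vappend 0 (lower_rows t))
        + snd ?F"
    by (simp add: kkt_jacobian_def kkt_data_derivative_def kkt_remainder_def vappend_add algebra_simps
        flip: vappend_add[of 0 _ 0, simplified])
  show ?thesis
    unfolding tlse_critical_def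
    unfolding right_minus_eq[symmetric, of _ "vappend _ _"] 1 2 z
    by (simp only: add_0 prod_eq_iff fst_zero snd_zero)
qed

lemma norm_kkt_remainder_le:
  assumes "norm \<delta> \<le> 1" "norm \<Delta> \<le> 1"
  shows "norm (kkt_remainder h x t \<delta> \<Delta>) \<le> (4 + norm h + norm t + norm x) * (norm \<delta> + norm \<Delta>)\<^sup>2"
proof -
  define a where "a = norm \<delta>"
  define c where "c = norm \<Delta>"
  have ac: "0 \<le> a" "0 \<le> c" "a \<le> 1" "c \<le> 1" using assms by (simp_all add: a_def c_def)
  have na: "norm (fst \<delta>) \<le> a" "norm (snd \<delta>) \<le> a"
    using norm_fst_le[of "fst \<delta>" "snd \<delta>"] norm_snd_le[of "snd \<delta>" "fst \<delta>"] by (simp_all add: a_def)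
  have nc: "norm (fst \<Delta>) \<le> c" "norm (snd \<Delta>) \<le> c"
    using norm_fst_le[of "fst \<Delta>" "snd \<Delta>"] norm_snd_le[of "snd \<Delta>" "fst \<Delta>"] by (simp_all add: c_def)
  have 1: "norm (snd \<delta> v* fst \<Delta>) \<le> a * c"
    by (rule order_trans[OF norm_vector_matrix_le mult_mono]) (use na nc ac in auto)
  have 2: "norm (fst \<Delta> *v fst \<delta>) \<le> c * a"
    by (rule order_trans[OF norm_matrix_vector_le mult_mono]) (use na nc ac in auto)
  have i: "\<bar>u \<bullet> v\<bar> \<le> p * q" if "norm u \<le> p" "norm v \<le> q" for u v :: "real^('b + 'c)" and p q
    by (rule order_trans[OF Cauchy_Schwarz_ineq2 mult_mono])
      (use that in \<open>auto intro: order_trans[OF norm_ge_zero]\<close>)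
  have 3: "norm ((h \<bullet> snd \<delta> + snd \<Delta> \<bullet> t) *\<^sub>R fst \<delta>) \<le> (norm h * a + c * norm t) * a"
    unfolding norm_scaleR
    by (rule mult_mono) (use i[OF order_refl na(2), of h] i[OF nc(2) order_refl, of t] na ac in
        \<open>auto intro: add_mono order_trans[OF abs_triangle_ineq]\<close>)
  have 4: "norm ((snd \<Delta> \<bullet> snd \<delta>) *\<^sub>R (x + fst \<delta>)) \<le> (c * a) * (norm x + 1)"
    unfolding norm_scaleR
    by (rule mult_mono) (use i[OF nc(2) na(2)] na ac norm_triangle_ineq[of x "fst \<delta>"] in auto)
  have "norm (kkt_remainder h x t \<delta> \<Delta>)
      \<le> norm (fst (kkt_remainder h x t \<delta> \<Delta>)) + norm (snd (kkt_remainder h x t \<delta> \<Delta>))"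
    by (metis norm_Pair_le prod.collapse)
  also have "\<dots> \<le> (a * c + (norm h * a + c * norm t) * a + (c * a) * (norm x + 1)) + c * a"
    unfolding kkt_remainder_def fst_conv snd_conv
    by (intro add_mono 2 order_trans[OF norm_triangle_ineq] 1 3 4)
  also have "\<dots> = norm h * (a * a) + (3 + norm t + norm x) * (a * c)"
    by (simp add: algebra_simps)
  also have "\<dots> \<le> norm h * (a + c)\<^sup>2 + (3 + norm t + norm x) * (a + c)\<^sup>2"
    using ac by (intro add_mono mult_left_mono) (auto simp: power2_eq_square algebra_simps)
  also have "\<dots> \<le> (4 + norm h + norm t + norm x) * (a + c)\<^sup>2"
    by (simp add: algebra_simps)
  finally show ?thesis by (simp add: a_def c_def)
qed

lemma linear_kkt_jacobian: "linear (kkt_jacobian L h x t)"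
proof -
  show ?thesis
    by (intro linearI) (simp_all add: kkt_jacobian_def prod_eq_iff inner_add_right
      scaleR_vector_matrix_assoc vappend_scaleR algebra_simps
      flip: vappend_add[of 0 _ 0, simplified])
qed

lemma bounded_linear_kkt_data_derivative: "bounded_linear (kkt_data_derivative x t)"
  unfolding linear_conv_bounded_linear[symmetric]
  by (intro linearI) (simp_all add: kkt_data_derivative_def prod_eq_iff inner_add_left
      vector_scaleR_matrix_ac scaleR_matrix_vector_assoc[symmetric] algebra_simps)

lemma continuous_on_kkt_remainder: "continuous_on UNIV (\<lambda>\<delta>. kkt_remainder h x t \<delta> \<Delta>)"
  unfolding kkt_remainder_def
  by (intro continuous_intros bounded_bilinear.continuous_on[OF bounded_bilinear_matrix_vector_mult]
      bounded_bilinear.continuous_on[OF bounded_bilinear_vector_matrix_mult])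

text \<open>
  The scalar \<open>h \<bullet> dt\<close> is eliminated by pairing the first linearised equation with \<open>x\<close> and the
  stationarity of \<open>x\<close> with \<open>dx\<close>: the terms in \<open>x \<bullet> dx\<close> cancel. What remains is a linear system
  for \<open>dx\<close> and the increment of the multiplier.
\<close>

lemma kkt_linearized_equations:
  fixes L \<Delta>L :: "real^'n^('p::finite + 'q::finite)"
  assumes crit: "tlse_critical L h x t"
    and lin: "kkt_jacobian L h x t (dx, dt) + kkt_data_derivative x t (\<Delta>L, \<Delta>h) = 0"
  defines "c \<equiv> \<Delta>L *v x - \<Delta>h"
  shows "upper_rows L *v dx = - upper_rows c"
    and "lower_rows dt = lower_rows L *v dx + lower_rows c"
    and "h \<bullet> dt = - (2 / (1 + (norm x)\<^sup>2)) * (t \<bullet> c) - \<Delta>h \<bullet> t"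
    and "upper_rows dt v* upper_rows L + (lower_rows L *v dx + lower_rows c) v* lower_rows L
       + (h \<bullet> t) *\<^sub>R dx + t v* \<Delta>L - (2 / (1 + (norm x)\<^sup>2) * (t \<bullet> c)) *\<^sub>R x = 0"
proof -
  let ?A = "lower_rows L" and ?C = "upper_rows L" and ?r = "lower_rows t"
  have eq1: "dt v* L + (h \<bullet> dt) *\<^sub>R x + (h \<bullet> t) *\<^sub>R dx + t v* \<Delta>L + (\<Delta>h \<bullet> t) *\<^sub>R x = 0"
    and eq2: "L *v dx - vappend 0 (lower_rows dt) + c = 0"
    using lin by (simp_all add: kkt_jacobian_def kkt_data_derivative_def prod_eq_iff c_def add.assoc)
  show up: "?C *v dx = - upper_rows c"
    using arg_cong[OF eq2, of upper_rows]
    by (simp add: rows_matrix_vector_mult eq_neg_iff_add_eq_0)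
  show low: "lower_rows dt = ?A *v dx + lower_rows c"
  proof -
    have "?A *v dx + lower_rows c - lower_rows dt = 0"
      using arg_cong[OF eq2, of lower_rows] by (simp add: rows_matrix_vector_mult algebra_simps)
    then show ?thesis by simp
  qed
  have Lx: "L *v x = h + vappend 0 ?r" and stat: "t v* L = - (h \<bullet> t) *\<^sub>R x"
    using crit by (simp_all add: tlse_critical_def algebra_simps eq_neg_iff_add_eq_0)
  \<comment> \<open>pairing the stationarity of \<open>x\<close> with \<open>dx\<close>\<close>
  have rA: "?r \<bullet> (?A *v dx) = - (h \<bullet> t) * (x \<bullet> dx) + upper_rows t \<bullet> upper_rows c"
  proof -
    have "t \<bullet> (L *v dx) = - (h \<bullet> t) * (x \<bullet> dx)"
      using arg_cong[OF stat, of "\<lambda>u. u \<bullet> dx"] by (simp add: dot_lmul_matrix)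
    then show ?thesis by (simp add: inner_Plus[of t] rows_matrix_vector_mult up)
  qed
  have rdt: "?r \<bullet> lower_rows dt = - (h \<bullet> t) * (x \<bullet> dx) + t \<bullet> c"
    by (simp add: low inner_add_right rA inner_Plus[of t c])
  have "0 = (dt v* L + (h \<bullet> dt) *\<^sub>R x + (h \<bullet> t) *\<^sub>R dx + t v* \<Delta>L + (\<Delta>h \<bullet> t) *\<^sub>R x) \<bullet> x"
    by (simp add: eq1)
  also have "\<dots> = dt \<bullet> (L *v x) + (h \<bullet> dt) * (norm x)\<^sup>2 + (h \<bullet> t) * (x \<bullet> dx)
      + t \<bullet> (\<Delta>L *v x) + (\<Delta>h \<bullet> t) * (norm x)\<^sup>2"
    by (simp add: inner_add_left dot_lmul_matrix power2_norm_eq_inner inner_commute[of dx x])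
  also have "dt \<bullet> (L *v x) = h \<bullet> dt - (h \<bullet> t) * (x \<bullet> dx) + t \<bullet> c"
    using rdt by (simp add: Lx inner_add_right inner_commute inner_Plus[of dt "vappend 0 ?r"])
  also have "t \<bullet> (\<Delta>L *v x) = t \<bullet> c + \<Delta>h \<bullet> t"
    by (simp add: c_def inner_diff_right inner_commute)
  finally have "(1 + (norm x)\<^sup>2) * (h \<bullet> dt + \<Delta>h \<bullet> t) = - 2 * (t \<bullet> c)"
    by (simp add: algebra_simps)
  moreover have "1 + (norm x)\<^sup>2 \<noteq> 0"
    by (metis add_pos_nonneg less_irrefl zero_le_power2 zero_less_one)
  ultimately show eta: "h \<bullet> dt = - (2 / (1 + (norm x)\<^sup>2)) * (t \<bullet> c) - \<Delta>h \<bullet> t"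
    by (simp add: field_simps)
  have "upper_rows dt v* ?C + (?A *v dx + lower_rows c) v* ?A + (h \<bullet> dt) *\<^sub>R x + (h \<bullet> t) *\<^sub>R dx
      + t v* \<Delta>L + (\<Delta>h \<bullet> t) *\<^sub>R x = 0"
    using eq1 unfolding rows_vector_matrix_mult[of dt] low .
  then show "upper_rows dt v* ?C + (?A *v dx + lower_rows c) v* ?A
       + (h \<bullet> t) *\<^sub>R dx + t v* \<Delta>L - (2 / (1 + (norm x)\<^sup>2) * (t \<bullet> c)) *\<^sub>R x = 0"
    unfolding eta by (simp add: scaleR_diff_left add_ac add_diff_eq)
qed

text \<open>
  For unperturbed data the linearised equations place \<open>dx\<close> in the kernel of \<open>C\<close> and, paired with
  \<open>dx\<close>, give \<open>|A dx|\<^sup>2 = \<sigma>\<^sup>2 |dx|\<^sup>2\<close>; positivity leaves \<open>dx = 0\<close>. Full row rank of \<open>C\<close> then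
  makes the increment of the multiplier vanish.
\<close>

lemma inj_kkt_jacobian:
  fixes L :: "real^'n^('p::finite + 'q::finite)"
  assumes crit: "tlse_critical L h x t"
    and rank: "rank (upper_rows L) = CARD('p)"
    and pos: "\<And>v. v \<noteq> 0 \<Longrightarrow> upper_rows L *v v = 0 \<Longrightarrow>
       - (h \<bullet> t) * (norm v)\<^sup>2 < (norm (lower_rows L *v v))\<^sup>2"
  shows "inj (kkt_jacobian L h x t)"
  unfolding linear_injective_0[OF linear_kkt_jacobian]
proof (intro allI impI)
  fix \<delta> assume \<delta>: "kkt_jacobian L h x t \<delta> = 0"
  obtain dx dt where dd: "\<delta> = (dx, dt)" by (cases \<delta>)
  have lin: "kkt_jacobian L h x t (dx, dt) + kkt_data_derivative x t (0, 0) = 0"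
    using \<delta> by (simp add: dd kkt_data_derivative_def prod_eq_iff)
  note eqs = kkt_linearized_equations[OF crit lin, simplified]
  have "0 = (upper_rows dt v* upper_rows L + (lower_rows L *v dx) v* lower_rows L + (h \<bullet> t) *\<^sub>R dx) \<bullet> dx"
    using eqs(4) by simp
  also have "\<dots> = upper_rows dt \<bullet> (upper_rows L *v dx) + (norm (lower_rows L *v dx))\<^sup>2 + (h \<bullet> t) * (norm dx)\<^sup>2"
    by (simp add: inner_add_left dot_lmul_matrix power2_norm_eq_inner)
  finally have "dx = 0" using pos[of dx] eqs(1) by (cases "dx = 0") auto
  then have "upper_rows dt v* upper_rows L = 0" "lower_rows dt = 0" using eqs(2,4) by simp_all
  moreover have "inj (\<lambda>u. u v* upper_rows L)"
  proof -
    have "(*v) (transpose (upper_rows L)) = (\<lambda>u. u v* upper_rows L)" by (simp add: fun_eq_iff)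
    then show ?thesis
      using rank full_rank_injective[of "transpose (upper_rows L)"] by (simp add: rank_transpose)
  qed
  ultimately have "upper_rows dt = 0" by (metis injD vector_matrix_mult_0)
  with \<open>lower_rows dt = 0\<close> have "dt = 0" by (metis vappend_rows rows_zero)
  with \<open>dx = 0\<close> show "\<delta> = 0" by (simp add: dd zero_prod_def)
qed

section \<open>Stability of the rank and positivity conditions\<close>

text \<open>
  The tube lemma, in the form in which it shows that conditions on all vectors of a
  finite-dimensional space survive small changes of the data.
\<close>

lemma eventually_on_unit_sphere:
  fixes W :: "('a::topological_space \<times> 'v::euclidean_space) set"
  assumes "open W" "\<And>v. norm v = 1 \<Longrightarrow> (a, v) \<in> W"
  shows "\<forall>\<^sub>F a' in nhds a. \<forall>v. norm v = 1 \<longrightarrow> (a', v) \<in> W"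
proof -
  have "{a} \<times> sphere (0 :: 'v) 1 \<subseteq> W"
  proof
    fix p assume "p \<in> {a} \<times> sphere (0 :: 'v) 1"
    then have "p = (a, snd p)" "norm (snd p) = 1" by (simp_all add: prod_eq_iff mem_Times_iff)
    with assms(2)[of "snd p"] show "p \<in> W" by simp
  qed
  from Elementary_Topology.tube_lemma[OF compact_sphere assms(1) this]
  obtain X where X: "a \<in> X" "open X" and sub: "X \<times> sphere (0 :: 'v) 1 \<subseteq> W"
    by (elim exE conjE)
  have "(a', v) \<in> W" if "a' \<in> X" "norm v = 1" for a' v
    by (rule subsetD[OF sub]) (simp add: that)
  with X show ?thesis unfolding eventually_nhds by meson
qed

lemma full_column_rank_iff: "rank M = CARD('n) \<longleftrightarrow> (\<forall>v. norm v = 1 \<longrightarrow> M *v v \<noteq> 0)"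
  for M :: "real^'n^'m"
proof -
  have "rank M = CARD('n) \<longleftrightarrow> (\<forall>v. M *v v = 0 \<longrightarrow> v = 0)"
    by (simp add: full_rank_injective vec.inj_iff_eq_0)
  also have "\<dots> \<longleftrightarrow> (\<forall>v. norm v = 1 \<longrightarrow> M *v v \<noteq> 0)"
  proof safe
    fix v assume *: "\<forall>v. norm v = 1 \<longrightarrow> M *v v \<noteq> 0" "M *v v = 0"
    show "v = 0"
    proof (rule ccontr)
      assume "v \<noteq> 0"
      with *(1)[rule_format, of "v /\<^sub>R norm v"] *(2) show False
        by (simp add: matrix_vector_mult_scaleR)
    qed
  qed auto
  finally show ?thesis .
qed

lemma eventually_full_column_rank:
  fixes M :: "real^'n^'m"
  assumes "rank M = CARD('n)"
  shows "\<forall>\<^sub>F M' in nhds M. rank M' = CARD('n)"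
proof -
  have "open {p :: (real^'n^'m) \<times> (real^'n). fst p *v snd p \<noteq> 0}"
    by (intro open_Collect_neq bounded_bilinear.continuous_on[OF bounded_bilinear_matrix_vector_mult]
        continuous_intros)
  from eventually_on_unit_sphere[OF this, of M] assms show ?thesis
    by (simp add: full_column_rank_iff)
qed

lemma eventually_full_row_rank:
  fixes L :: "real^'n^('p::finite + 'q::finite)"
  assumes "rank (upper_rows L) = CARD('p)"
  shows "\<forall>\<^sub>F L' in nhds L. rank (upper_rows L') = CARD('p)"
proof -
  have "bounded_linear (\<lambda>L :: real^'n^('p + 'q). transpose (upper_rows L))"
    by (rule linear_conv_bounded_linear[THEN iffD1])
      (auto intro!: linearI simp: vec_eq_iff transpose_def)
  from bounded_linear.tendsto[OF this filterlim_ident]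
  have "filterlim (\<lambda>L. transpose (upper_rows L)) (nhds (transpose (upper_rows L))) (nhds L)" .
  from eventually_compose_filterlim[OF eventually_full_column_rank this] assms show ?thesis
    by (simp add: rank_transpose)
qed

text \<open>
  The kernel of \<open>C\<close> may move with the data. The condition is therefore read on the whole unit sphere
  as the open alternative \<open>C v \<noteq> 0\<close> or \<open>\<sigma>\<^sup>2 < |A v|\<^sup>2\<close>.
\<close>

lemma eventually_positive_on_kernel:
  fixes L :: "real^'n^('p::finite + 'q::finite)" and h t :: "real^('p + 'q)"
  assumes "\<And>v. v \<noteq> 0 \<Longrightarrow> upper_rows L *v v = 0 \<Longrightarrow>
       - (h \<bullet> t) * (norm v)\<^sup>2 < (norm (lower_rows L *v v))\<^sup>2"
  shows "\<forall>\<^sub>F (L', h', t') in nhds (L, h, t). \<forall>v. v \<noteq> 0 \<longrightarrow> upper_rows L' *v v = 0 \<longrightarrow>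
       - (h' \<bullet> t') * (norm v)\<^sup>2 < (norm (lower_rows L' *v v))\<^sup>2"
proof -
  let ?P = "\<lambda>((L' :: real^'n^('p + 'q), h', t'), v). upper_rows L' *v v \<noteq> 0 \<or>
       - (h' \<bullet> t') < (norm (lower_rows L' *v v))\<^sup>2"
  have "open {p. ?P p}"
    unfolding case_prod_unfold
    by (intro open_Collect_disj open_Collect_neq open_Collect_less continuous_intros
        bounded_bilinear.continuous_on[OF bounded_bilinear_matrix_vector_mult]
        bounded_linear.continuous_on[OF bounded_linear_upper_rows]
        bounded_linear.continuous_on[OF bounded_linear_lower_rows])
  then have "\<forall>\<^sub>F a in nhds (L, h, t). \<forall>v. norm v = 1 \<longrightarrow> (a, v) \<in> {p. ?P p}"
  proof (rule eventually_on_unit_sphere)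
    fix v :: "real^'n" assume "norm v = 1"
    then have "v \<noteq> 0" "(norm v)\<^sup>2 = 1" by auto
    with assms[of v] show "((L, h, t), v) \<in> {p. ?P p}" by simp
  qed
  then show ?thesis
  proof (rule eventually_mono, clarsimp)
    fix L' :: "real^'n^('p + 'q)" and h' t' :: "real^('p + 'q)" and v :: "real^'n"
    assume *: "\<forall>v. norm v = 1 \<longrightarrow> upper_rows L' *v v = 0 \<longrightarrow> - (h' \<bullet> t') < (norm (lower_rows L' *v v))\<^sup>2"
      and v: "v \<noteq> 0" "upper_rows L' *v v = 0"
    have "- (h' \<bullet> t') < (norm (lower_rows L' *v (v /\<^sub>R norm v)))\<^sup>2"
      using v by (intro *[rule_format]) (simp_all add: matrix_vector_mult_scaleR)
    also have "\<dots> = (norm (lower_rows L' *v v))\<^sup>2 / (norm v)\<^sup>2"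
      by (simp add: matrix_vector_mult_scaleR divide_inverse power_mult_distrib power_inverse mult.commute)
    finally show "- (h' \<bullet> t' * (norm v)\<^sup>2) < (norm (lower_rows L' *v v))\<^sup>2"
      using v by (simp add: pos_less_divide_eq)
  qed
qed

section \<open>First-order expansion of the solution map\<close>

text \<open>
  Here \<open>D\<close> is any description of the \<open>x\<close>-part of the solution of the linearised equations.
  The nearby critical point found by \<open>perturbed_zero_to_second_order\<close> still satisfies the rank and
  positivity conditions, and these identify it with the solution of the perturbed problem.
\<close>

lemma tlse_map_expansion:
  fixes L :: "real^'n^('p::finite + 'q::finite)"
  assumes crit: "tlse_critical L h x t"
    and rank: "rank (upper_rows L) = CARD('p)" "rank L = CARD('n)"
    and pos: "\<And>v. v \<noteq> 0 \<Longrightarrow> upper_rows L *v v = 0 \<Longrightarrow>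
       - (h \<bullet> t) * (norm v)\<^sup>2 < (norm (lower_rows L *v v))\<^sup>2"
    and D: "\<And>\<Delta> \<delta>. kkt_jacobian L h x t \<delta> + kkt_data_derivative x t \<Delta> = 0 \<Longrightarrow> fst \<delta> = D \<Delta>"
  shows "tlse_uniquely_solvable L h"
    and "tlse_map L h = x"
    and "\<forall>\<^sub>F \<Delta> in nhds 0. tlse_uniquely_solvable (L + fst \<Delta>) (h + snd \<Delta>)"
    and "(\<lambda>\<Delta>. norm (tlse_map (L + fst \<Delta>) (h + snd \<Delta>) - x - D \<Delta>)) \<in> O[nhds 0](\<lambda>\<Delta>. (norm \<Delta>)\<^sup>2)"
proof -
  let ?good = "\<lambda>(L' :: real^'n^('p + 'q), h', t').
    rank (upper_rows L') = CARD('p) \<and> rank L' = CARD('n) \<and>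
    (\<forall>v. v \<noteq> 0 \<longrightarrow> upper_rows L' *v v = 0 \<longrightarrow>
       - (h' \<bullet> t') * (norm v)\<^sup>2 < (norm (lower_rows L' *v v))\<^sup>2)"
  have solved: "tlse_uniquely_solvable L' h' \<and> tlse_map L' h' = x'"
    if "tlse_critical L' h' x' t'" "?good (L', h', t')" for L' :: "real^'n^('p + 'q)" and h' x' t'
  proof -
    have "tlse_solution_data L' h' y \<longleftrightarrow> y = x'" for y
      using that by (intro tlse_critical_unique_solution) auto
    then show ?thesis using that(2) by (simp add: tlse_uniquely_solvable_def tlse_map_def)
  qed
  have good: "?good (L, h, t)" using rank pos by simp
  show "tlse_uniquely_solvable L h" "tlse_map L h = x"
    using solved[OF crit good] by simp_all
  have fst_lim: "filterlim fst (nhds L) (nhds (L, h, t))"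
    using tendsto_fst[OF filterlim_ident, of "(L, h, t)"] by simp
  have pos_near: "\<forall>\<^sub>F (L', h', t') in nhds (L, h, t). \<forall>v. v \<noteq> 0 \<longrightarrow> upper_rows L' *v v = 0 \<longrightarrow>
       - (h' \<bullet> t') * (norm v)\<^sup>2 < (norm (lower_rows L' *v v))\<^sup>2"
    by (rule eventually_positive_on_kernel) (rule pos)
  have "eventually ?good (nhds (L, h, t))"
    using eventually_compose_filterlim[OF eventually_full_row_rank[OF rank(1)] fst_lim]
      eventually_compose_filterlim[OF eventually_full_column_rank[OF rank(2)] fst_lim]
      pos_near
    by eventually_elim auto
  then obtain e2 where e2: "e2 > 0" "\<And>p. dist p (L, h, t) < e2 \<Longrightarrow> ?good p"
    unfolding eventually_nhds_metric by blast
  obtain k e1 where k: "0 \<le> k" and e1: "0 < e1"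
    and root: "\<And>\<Delta>. norm \<Delta> < e1 \<Longrightarrow> \<exists>\<delta> g. kkt_jacobian L h x t \<delta> + kkt_data_derivative x t \<Delta>
         + kkt_remainder h x t \<delta> \<Delta> = 0 \<and> norm \<delta> \<le> k * norm \<Delta> \<and>
       kkt_jacobian L h x t g + kkt_data_derivative x t \<Delta> = 0 \<and> norm (\<delta> - g) \<le> k * (norm \<Delta>)\<^sup>2"
    by (rule perturbed_zero_to_second_order[OF linear_kkt_jacobian inj_kkt_jacobian[OF crit rank(1) pos]
          bounded_linear_kkt_data_derivative[of x t] continuous_on_kkt_remainder[of h x t]
          norm_kkt_remainder_le]) blast+
  define e where "e = min e1 (e2 / (2 + k))"
  have "e > 0" using e1 e2(1) k by (simp add: e_def)
  have main: "tlse_uniquely_solvable (L + fst \<Delta>) (h + snd \<Delta>) \<and>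
      norm (tlse_map (L + fst \<Delta>) (h + snd \<Delta>) - x - D \<Delta>) \<le> k * (norm \<Delta>)\<^sup>2"
    if "norm \<Delta> < e" for \<Delta>
  proof -
    obtain \<delta> g where \<delta>: "kkt_jacobian L h x t \<delta> + kkt_data_derivative x t \<Delta> + kkt_remainder h x t \<delta> \<Delta> = 0"
      "norm \<delta> \<le> k * norm \<Delta>"
      and g: "kkt_jacobian L h x t g + kkt_data_derivative x t \<Delta> = 0" "norm (\<delta> - g) \<le> k * (norm \<Delta>)\<^sup>2"
      using root[of \<Delta>] \<open>norm \<Delta> < e\<close> by (auto simp: e_def)
    have "tlse_critical (L + fst \<Delta>) (h + snd \<Delta>) (x + fst \<delta>) (t + snd \<delta>)"
      using \<delta>(1) by (simp only: tlse_critical_expansion[OF crit])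
    moreover have "?good (L + fst \<Delta>, h + snd \<Delta>, t + snd \<delta>)"
    proof (rule e2(2))
      have "dist (L + fst \<Delta>, h + snd \<Delta>, t + snd \<delta>) (L, h, t) = norm (fst \<Delta>, snd \<Delta>, snd \<delta>)"
        by (simp add: dist_norm)
      also have "\<dots> \<le> norm (fst \<Delta>) + (norm (snd \<Delta>) + norm (snd \<delta>))"
        by (rule order_trans[OF norm_Pair_le add_left_mono[OF norm_Pair_le]])
      also have "\<dots> \<le> norm \<Delta> + (norm \<Delta> + k * norm \<Delta>)"
        using \<delta>(2) norm_fst_le[of "fst \<Delta>" "snd \<Delta>"] norm_snd_le[of "snd \<Delta>" "fst \<Delta>"]
          norm_snd_le[of "snd \<delta>" "fst \<delta>"] by (intro add_mono) auto
      also have "\<dots> = (2 + k) * norm \<Delta>" by (simp add: algebra_simps)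
      also have "\<dots> < e2"
        using \<open>norm \<Delta> < e\<close> k by (simp add: e_def pos_less_divide_eq mult.commute)
      finally show "dist (L + fst \<Delta>, h + snd \<Delta>, t + snd \<delta>) (L, h, t) < e2" .
    qed
    ultimately have sol: "tlse_uniquely_solvable (L + fst \<Delta>) (h + snd \<Delta>)"
      "tlse_map (L + fst \<Delta>) (h + snd \<Delta>) = x + fst \<delta>" using solved by blast+
    have "norm (fst (\<delta> - g)) \<le> k * (norm \<Delta>)\<^sup>2"
      by (rule order_trans[OF norm_fst_le[of "fst (\<delta> - g)" "snd (\<delta> - g)", unfolded prod.collapse] g(2)])
    with sol D[OF g(1)] show ?thesis by simp
  qed
  have near: "\<forall>\<^sub>F \<Delta> in nhds 0. norm (\<Delta> :: (real^'n^('p + 'q)) \<times> (real^('p + 'q))) < e"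
    unfolding eventually_nhds_metric using \<open>e > 0\<close> by (auto intro!: exI[of _ e])
  then show "\<forall>\<^sub>F \<Delta> in nhds 0. tlse_uniquely_solvable (L + fst \<Delta>) (h + snd \<Delta>)"
    by eventually_elim (use main in blast)
  show "(\<lambda>\<Delta>. norm (tlse_map (L + fst \<Delta>) (h + snd \<Delta>) - x - D \<Delta>)) \<in> O[nhds 0](\<lambda>\<Delta>. (norm \<Delta>)\<^sup>2)"
    by (rule bigoI[of _ k]) (use near in \<open>eventually_elim, use main in simp\<close>)
qed

text \<open>
  Adding \<open>P c\<close> for the upper part of \<open>c\<close> moves \<open>dx\<close> into the kernel of \<open>C\<close>, where \<open>K\<close> inverts
  \<open>A\<^sup>T A - \<sigma>\<^sup>2 I\<close>. Applying \<open>K\<close> to the linearised stationarity equation removes the unknown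
  multiplier, since \<open>K C\<^sup>T = 0\<close>.
\<close>

lemma tlse_derivative_formula:
  fixes L \<Delta>L :: "real^'n^('p::finite + 'q::finite)" and K :: "real^'n^'n" and P :: "real^'p^'n"
  assumes crit: "tlse_critical L h x t"
    and lin: "kkt_jacobian L h x t (dx, dt) + kkt_data_derivative x t (\<Delta>L, \<Delta>h) = 0"
    and KC: "\<And>u. K *v (u v* upper_rows L) = 0"
    and KS: "\<And>w. upper_rows L *v w = 0 \<Longrightarrow>
      K *v ((lower_rows L *v w) v* lower_rows L + (h \<bullet> t) *\<^sub>R w) = w"
    and CP: "\<And>u. upper_rows L *v (P *v u) = u"
    and KP: "\<And>u. K *v (P *v u) = 0"
  defines "c \<equiv> \<Delta>L *v x - \<Delta>h"
  shows "dx = (2 / (1 + (norm x)\<^sup>2) * (t \<bullet> c)) *\<^sub>R (K *v x)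
      - (P *v upper_rows c - K *v ((lower_rows L *v (P *v upper_rows c)) v* lower_rows L))
      - K *v (lower_rows c v* lower_rows L) - K *v (t v* \<Delta>L)"
proof -
  let ?A = "lower_rows L" and ?p = "P *v upper_rows c"
  note eqs = kkt_linearized_equations[OF crit lin, folded c_def]
  define w where "w = dx + ?p"
  have "upper_rows L *v w = 0" by (simp add: w_def matrix_vector_right_distrib eqs(1) CP)
  from KS[OF this] have "w = K *v ((?A *v dx) v* ?A + (h \<bullet> t) *\<^sub>R dx) + K *v ((?A *v ?p) v* ?A)"
    by (simp add: w_def KP algebra_simps)
  moreover have "K *v ((?A *v dx) v* ?A + (h \<bullet> t) *\<^sub>R dx)
      = (2 / (1 + (norm x)\<^sup>2) * (t \<bullet> c)) *\<^sub>R (K *v x) - K *v (lower_rows c v* ?A) - K *v (t v* \<Delta>L)"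
  proof -
    have "(?A *v dx) v* ?A + (h \<bullet> t) *\<^sub>R dx = (2 / (1 + (norm x)\<^sup>2) * (t \<bullet> c)) *\<^sub>R x
        - lower_rows c v* ?A - t v* \<Delta>L - upper_rows dt v* upper_rows L"
      using eqs(4) by (simp add: algebra_simps)
    then show ?thesis
      by (simp add: matrix_vector_mult_diff_distrib KC matrix_vector_mult_scaleR)
  qed
  moreover have "dx = w - ?p" by (simp add: w_def)
  ultimately show ?thesis by simp
qed

section \<open>Kronecker products acting on stacked columns\<close>

lemma kronecker_rowvector_vec_cols:
  "drop_unit_left (kronecker (rowvector x :: real^'n^1) H) *v vec_cols M = H *v (M *v x)"
  unfolding vec_eq_iff
proof
  fix i
  have "(drop_unit_left (kronecker (rowvector x :: real^'n^1) H) *v vec_cols M) $ i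
      = (\<Sum>j\<in>UNIV. \<Sum>l\<in>UNIV. H $ i $ l * (M $ l $ j * x $ j))"
    by (simp add: matrix_vector_mult_def drop_unit_left_def kronecker_def rowvector_def vec_cols_def
        sum_UNIV_Times mult_ac)
  also have "\<dots> = (H *v (M *v x)) $ i"
    by (subst sum.swap) (simp add: matrix_vector_mult_def sum_distrib_left)
  finally show "(drop_unit_left (kronecker (rowvector x :: real^'n^1) H) *v vec_cols M) $ i
      = (H *v (M *v x)) $ i" .
qed

lemma kronecker_mat_1_vec_cols:
  "drop_unit_right (kronecker (mat 1 :: real^'n^'n) (rowvector t :: real^'m^1)) *v vec_cols M = t v* M"
proof -
  have "(\<Sum>j\<in>UNIV. \<Sum>l\<in>UNIV. (if i = j then 1 else 0) * t $ l * M $ l $ j) = (\<Sum>l\<in>UNIV. t $ l * M $ l $ i)"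
    for i
  proof -
    have "(\<Sum>j\<in>UNIV. \<Sum>l\<in>UNIV. (if i = j then 1 else 0) * t $ l * M $ l $ j)
        = (\<Sum>j\<in>UNIV. if i = j then \<Sum>l\<in>UNIV. t $ l * M $ l $ j else 0)"
      by (intro sum.cong) auto
    then show ?thesis by simp
  qed
  then show ?thesis
    by (simp add: vec_eq_iff matrix_vector_mult_def vector_matrix_mult_def drop_unit_right_def
        kronecker_def rowvector_def vec_cols_def sum_UNIV_Times mat_def)
qed

lemma reindex_cols_vec_cols_augment:
  "reindex_cols N *v vec_cols (augment M v) = N *v vappend (vec_cols M) v"
  by (simp add: vec_eq_iff matrix_vector_mult_def reindex_cols_def vec_cols_def augment_def hcat_def
      columnvector_def sum_UNIV_Times sum_UNIV_Plus)

section \<open>The critical point given by the genericity condition\<close>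

text \<open>
  Points of the affine space \<open>C x = d\<close> are \<open>x = u + Q y\<close>, with \<open>A x - b = B y + g\<close> for \<open>B = A Q\<close> and
  \<open>g = A u - b\<close>, and \<open>1 + |x|\<^sup>2 = |y|\<^sup>2 + 1 / \<zeta>\<^sup>2\<close>. The ratio is thus the gain of \<open>[B, \<zeta> g]\<close> at
  \<open>(y, 1 / \<zeta>)\<close>, and a singular vector scaled to have last component \<open>1 / \<zeta>\<close> is a critical point.
\<close>

lemma tlse_critical_from_singular_vector:
  fixes A :: "real^'n^'q" and C :: "real^'n^'p" and Q :: "real^'k^'n" and P :: "real^'p^'n"
  assumes CQ: "\<And>y. C *v (Q *v y) = 0"
    and QQ: "\<And>y. (Q *v y) v* Q = y"
    and ker: "\<And>v. C *v v = 0 \<Longrightarrow> v = Q *v (v v* Q)"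
    and CP: "\<And>u. C *v (P *v u) = u"
    and Cu: "C *v u = d" and uQ: "u v* Q = 0"
    and \<zeta>: "\<zeta> = 1 / sqrt (1 + (norm u)\<^sup>2)"
    and gap: "\<And>y. \<beta> * norm y \<le> norm ((A ** Q) *v y)" "0 \<le> s" "s < \<beta>"
    and sv: "z \<noteq> 0"
      "(transpose (augment (A ** Q) (\<zeta> *\<^sub>R (A *v u - b))) ** augment (A ** Q) (\<zeta> *\<^sub>R (A *v u - b))) *v z
        = s\<^sup>2 *\<^sub>R z"
  obtains x t where "tlse_critical (vcat C A) (vappend d b) x t" "vappend d b \<bullet> t = - s\<^sup>2"
proof -
  let ?B = "A ** Q" and ?g = "A *v u - b"
  let ?M = "augment ?B (\<zeta> *\<^sub>R ?g)"
  define c where "c = 1 + (norm u)\<^sup>2"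
  have c: "c > 0" by (simp add: c_def add_pos_nonneg)
  have \<zeta>c: "\<zeta> > 0" "\<zeta> * \<zeta> * c = 1"
    using c by (simp_all add: \<zeta> c_def[symmetric])
  have z_split: "z = vappend (upper_rows z) (\<chi> _. z $ Inr 1)"
    by (simp add: vec_eq_Plus_iff)
  \<comment> \<open>the gap rules out that the last component vanishes\<close>
  have z1: "z $ Inr 1 \<noteq> 0"
  proof
    assume z1: "z $ Inr 1 = 0"
    let ?y = "upper_rows z"
    have "?y \<noteq> 0"
    proof
      assume "?y = 0"
      with z1 have "z = vappend 0 (\<chi> _. 0)" using z_split by simp
      then show False using sv(1) by (simp add: vec_eq_Plus_iff)
    qed
    have "z \<bullet> z = ?y \<bullet> ?y"
      using z1 by (subst (1 2) z_split) (simp add: inner_Plus inner_vec_def)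
    then have nz: "(norm z)\<^sup>2 = (norm ?y)\<^sup>2" by (simp add: power2_norm_eq_inner)
    have "?M *v z = ?B *v ?y" using z1 by (simp add: augment_vector)
    moreover have "(?M *v z) \<bullet> (?M *v z) = s\<^sup>2 * (norm z)\<^sup>2"
      unfolding inner_gram[symmetric] sv(2) by (simp add: power2_norm_eq_inner)
    ultimately have "(norm (?B *v ?y))\<^sup>2 = (s * norm ?y)\<^sup>2"
      by (simp add: power2_norm_eq_inner[of "?B *v ?y"] nz power_mult_distrib)
    then have "norm (?B *v ?y) = s * norm ?y"
      using gap(2) by (simp add: power2_eq_iff_nonneg)
    with gap(1)[of ?y] have "\<beta> * norm ?y \<le> s * norm ?y" by simp
    with gap(3) \<open>?y \<noteq> 0\<close> show False by simp
  qed
  \<comment> \<open>scales the last component to \<open>1 / \<zeta>\<close>\<close>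
  define a where "a = 1 / (\<zeta> * z $ Inr 1)"
  define y where "y = a *\<^sub>R upper_rows z"
  define r where "r = ?B *v y + ?g"
  have az: "a * (z $ Inr 1) = 1 / \<zeta>" using z1 by (simp add: a_def)
  have Mz: "?M *v (a *\<^sub>R z) = r"
    using az \<zeta>c(1) by (simp add: augment_vector r_def y_def)
  have "r v* ?M = a *\<^sub>R ((transpose ?M ** ?M) *v z)"
    by (simp add: Mz[symmetric] matrix_vector_mul_assoc[symmetric] matrix_vector_mult_scaleR
        scaleR_vector_matrix_assoc)
  then have "r v* ?M = s\<^sup>2 *\<^sub>R (a *\<^sub>R z)" unfolding sv(2) by (simp add: mult.commute)
  then have eig: "vappend (r v* ?B) (\<chi> _. r \<bullet> (\<zeta> *\<^sub>R ?g)) = s\<^sup>2 *\<^sub>R (a *\<^sub>R z)"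
    by (simp add: vector_augment)
  have rB: "r v* ?B = s\<^sup>2 *\<^sub>R y"
    using arg_cong[OF eig, of upper_rows] by (simp add: y_def)
  have "1 / \<zeta> = \<zeta> * c" using \<zeta>c by (simp add: field_simps)
  moreover have "r \<bullet> (\<zeta> *\<^sub>R ?g) = s\<^sup>2 * (1 / \<zeta>)"
    using arg_cong[OF eig, of "\<lambda>w. w $ Inr 1"] by (simp add: az mult.assoc)
  ultimately have "\<zeta> * (r \<bullet> ?g) = \<zeta> * (s\<^sup>2 * c)"
    by (simp only: inner_scaleR_right mult.left_commute)
  then have rg: "r \<bullet> ?g = s\<^sup>2 * c" using \<zeta>c(1) by simp
  define x where "x = u + Q *v y"
  have Ax: "A *v x - b = r"
    by (simp add: x_def r_def matrix_vector_right_distrib matrix_vector_mul_assoc)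
  have Cx: "C *v x = d" by (simp add: x_def matrix_vector_right_distrib Cu CQ)
  have "u \<bullet> (Q *v y) = 0" "(Q *v y) \<bullet> (Q *v y) = y \<bullet> y"
    using uQ QQ[of y] by (simp_all add: dot_lmul_matrix[symmetric])
  then have nx: "(norm x)\<^sup>2 = (norm u)\<^sup>2 + (norm y)\<^sup>2"
    by (simp add: x_def power2_norm_eq_inner inner_add_left inner_add_right inner_commute)
  have rr: "(norm r)\<^sup>2 = s\<^sup>2 * (1 + (norm x)\<^sup>2)"
  proof -
    have "(norm r)\<^sup>2 = (r v* ?B) \<bullet> y + r \<bullet> ?g"
      by (simp add: power2_norm_eq_inner dot_lmul_matrix) (simp add: r_def inner_add_left inner_add_right inner_commute)
    also have "\<dots> = s\<^sup>2 * (norm y)\<^sup>2 + s\<^sup>2 * c"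
      by (simp only: rB rg inner_scaleR_left power2_norm_eq_inner)
    finally show ?thesis by (simp add: nx c_def algebra_simps)
  qed
  define v where "v = r v* A - s\<^sup>2 *\<^sub>R x"
  have vQ: "v v* Q = 0"
    using rB by (simp add: v_def x_def vector_matrix_mult_diff_distrib scaleR_vector_matrix_assoc
        vector_matrix_left_distrib uQ QQ vector_matrix_mul_assoc)
  \<comment> \<open>The vector \<open>v\<close> is orthogonal to the kernel of \<open>C\<close>, and \<open>w - P C w\<close> lies in this kernel,
    so \<open>v\<close> lies in the row space of \<open>C\<close> with multiplier \<open>l\<close>.\<close>
  define l where "l = v v* P"
  have lC: "l v* C = v"
  proof (rule vector_eq_rdot[THEN iffD1], intro allI)
    fix w
    have "C *v (w - P *v (C *v w)) = 0" by (simp add: matrix_vector_mult_diff_distrib CP)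
    from ker[OF this] have "v \<bullet> (w - P *v (C *v w)) = 0"
      by (metis dot_lmul_matrix inner_zero_left vQ)
    then show "(l v* C) \<bullet> w = v \<bullet> w"
      by (simp add: l_def dot_lmul_matrix inner_diff_right)
  qed
  define t where "t = vappend (- l) r"
  have ht: "vappend d b \<bullet> t = - s\<^sup>2"
  proof -
    have "d \<bullet> l = v \<bullet> x"
      using dot_lmul_matrix[of l C x] unfolding lC Cx by (simp only: inner_commute)
    also have "\<dots> = r \<bullet> (A *v x) - s\<^sup>2 * (norm x)\<^sup>2"
      by (simp add: v_def inner_diff_left dot_lmul_matrix power2_norm_eq_inner)
    also have "A *v x = r + b" using Ax by (simp add: algebra_simps)
    finally have "d \<bullet> l = (norm r)\<^sup>2 + b \<bullet> r - s\<^sup>2 * (norm x)\<^sup>2"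
      by (simp add: inner_add_right inner_commute power2_norm_eq_inner)
    then show ?thesis by (simp add: t_def inner_Plus rr algebra_simps)
  qed
  have "tlse_critical (vcat C A) (vappend d b) x t"
    unfolding tlse_critical_def
  proof
    have "(- l) v* C = - v"
      using lC by (simp add: uminus_vector_matrix_mult)
    then show "t v* vcat C A + (vappend d b \<bullet> t) *\<^sub>R x = 0"
      unfolding ht by (simp add: rows_vector_matrix_mult t_def v_def)
    show "vcat C A *v x - vappend d b = vappend 0 (lower_rows t)"
      using Cx Ax by (simp add: vec_eq_Plus_iff vec_eq_iff t_def matrix_vector_mult_def)
  qed
  then show thesis using ht by (rule that)
qed

section \<open>The first-order perturbation estimate\<close>

theorem theorem3p5:
  fixes A :: "real^'n^'q" and b :: "real^'q"
    and C :: "real^'n^'p::{finite,linorder}" and d :: "real^'p::{finite,linorder}"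
    and L :: "real^'n^('p + 'q)" and h :: "real^('p + 'q)"
    and Q1 :: "real^'p::{finite,linorder}^'n" and Q2 :: "real^'k^'n" and R1 :: "real^'p::{finite,linorder}^'p::{finite,linorder}"
    and x xC :: "real^'n" and r rC :: "real^'q" and t :: "real^('p + 'q)"
    and \<zeta> \<rho> \<sigma>bar \<sigma>tilde :: real
    and S11 :: "real^'k^'k" and K :: "real^'n^'n" and CA :: "real^'p::{finite,linorder}^'n"
    and H1 :: "real^('p + 'q)^'n" and H2 :: "real^('n \<times> ('p + 'q))^'n"
    and Kblock :: "real^(('n \<times> ('p + 'q)) + ('p + 'q))^'n"
    and Kbar :: "real^(('n + 1) \<times> ('p + 'q))^'n"
  assumes q_gt_n: "CARD('q) > CARD('n)"
    and card_k: "CARD('k) = CARD('n) - CARD('p)" "CARD('p) < CARD('n)"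
    and L_def: "L = vcat C A" and h_def: "h = vappend d b"
    and rank_C: "rank C = CARD('p)" and rank_L: "rank L = CARD('n)"
    and Q_orthogonal:
      "transpose (hcat Q1 Q2) ** hcat Q1 Q2 = mat 1"
      "hcat Q1 Q2 ** transpose (hcat Q1 Q2) = mat 1"
    and R1_upper: "\<And>i j. j < i \<Longrightarrow> R1 $ i $ j = 0"
    and QR: "transpose C = hcat Q1 Q2 ** vcat R1 (0 :: real^'p::{finite,linorder}^'k)"
    and xC_def: "xC = pinv C *v d"
    and rC_def: "rC = A *v xC - b"
    and zeta_def: "\<zeta> = 1 / sqrt (1 + (norm xC)\<^sup>2)"
    and sigmabar_def: "\<sigma>bar = singular_value (CARD('n) - CARD('p)) (A ** Q2)"
    and sigmatilde_def:
      "\<sigma>tilde = singular_value (CARD('n) - CARD('p) + 1) (augment (A ** Q2) (\<zeta> *\<^sub>R rC))"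
    and genericity: "\<sigma>bar > \<sigma>tilde"
    and S11_def: "S11 = transpose Q2 ** transpose A ** A ** Q2 - \<sigma>tilde\<^sup>2 *\<^sub>R mat 1"
    and K_def: "K = Q2 ** matrix_inv S11 ** transpose Q2"
    and CA_def: "CA = (mat 1 - K ** transpose A ** A) ** pinv C"
    and x_def: "x = tlse_map L h"
    and r_def: "r = A *v x - b"
    and rho_def: "\<rho> = sqrt (1 + (norm x)\<^sup>2)"
    and t_def: "t = vappend (- (r v* (augment A b ** pinv (augment C d)))) r"
    and H1_def:
      "H1 = (2 / \<rho>\<^sup>2) *\<^sub>R (K ** (columnvector x :: real^1^'n) ** (rowvector t :: real^('p + 'q)^1))
            - hcat CA (K ** transpose A)"
    and H2_def:
      "H2 = K ** drop_unit_right (kronecker (mat 1 :: real^'n^'n) (rowvector t :: real^('p + 'q)^1))"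
    and Kblock_def:
      "Kblock = hcat (drop_unit_left (kronecker (rowvector x :: real^'n^1) H1) - H2) (- H1)"
    and Kbar_def: "Kbar = reindex_cols Kblock"
  shows "tlse_uniquely_solvable L h
    \<and> (\<forall>\<^sub>F (\<Delta>L, \<Delta>h) in nhds (0, 0). tlse_uniquely_solvable (L + \<Delta>L) (h + \<Delta>h))
    \<and> (\<lambda>(\<Delta>L, \<Delta>h). norm (tlse_map (L + \<Delta>L) (h + \<Delta>h) - tlse_map L h
            - Kbar *v vec_cols (augment \<Delta>L \<Delta>h)))
        \<in> O[nhds (0, 0)](\<lambda>(\<Delta>L, \<Delta>h). (norm (augment \<Delta>L \<Delta>h))\<^sup>2)
    \<and> (\<forall>\<Delta>L \<Delta>h. Kbar *v vec_cols (augment \<Delta>L \<Delta>h) = Kblock *v vappend (vec_cols \<Delta>L) \<Delta>h)"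
proof -
  let ?Q = "hcat Q1 Q2" and ?P = "pinv C" and ?B = "A ** Q2" and ?k = "CARD('n) - CARD('p)"
  have k: "?k = CARD('k)" "?k + 1 = CARD('k + 1)" using card_k(1) by simp_all
  have CP: "C *v (?P *v u) = u" for u
    using pinv_full_row_rank(1)[OF rank_C] by (simp add: matrix_vector_mul_assoc)
  have C_Q: "C *v (?Q *v z) = upper_rows z v* R1" for z
  proof -
    have "C = transpose (?Q ** vcat R1 (0 :: real^'p::{finite,linorder}^'k))"
      using arg_cong[OF QR, of transpose] by simp
    then have "C *v (?Q *v z) = ((?Q *v z) v* ?Q) v* vcat R1 (0 :: real^'p::{finite,linorder}^'k)"
      by (simp add: vector_matrix_mul_assoc)
    also have "(?Q *v z) v* ?Q = z"
      using Q_orthogonal(1) by (metis matrix_vector_mul_assoc matrix_vector_mul_lid transpose_matrix_vector)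
    finally show ?thesis by (simp add: rows_vector_matrix_mult[of z])
  qed
  have Q_inv: "?Q *v (v v* ?Q) = v" for v
    using Q_orthogonal(2) by (metis matrix_vector_mul_assoc matrix_vector_mul_lid transpose_matrix_vector)
  have Q_left: "(?Q *v z) v* ?Q = z" for z
    using Q_orthogonal(1) by (metis matrix_vector_mul_assoc matrix_vector_mul_lid transpose_matrix_vector)
  have Q_vec: "v v* ?Q = vappend (v v* Q1) (v v* Q2)" for v
    by (simp add: vec_eq_Plus_iff vector_matrix_mult_def hcat_def)
  have CQ: "C *v (Q2 *v y) = 0" for y
    using C_Q[of "vappend 0 y"] by (simp add: hcat_vappend)
  have QQ: "(Q2 *v y) v* Q2 = y" for y
    using arg_cong[OF Q_left[of "vappend 0 y"], of lower_rows] by (simp add: hcat_vappend Q_vec)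
  have ker: "v = Q2 *v (v v* Q2)" if "C *v v = 0" for v
  proof -
    have lin: "linear (\<lambda>u :: real^'p::{finite,linorder}. u v* R1)"
      by (simp add: linear_iff vector_matrix_left_distrib scaleR_vector_matrix_assoc)
    \<comment> \<open>\<open>R1\<close> inherits invertibility from the full row rank of \<open>C\<close>\<close>
    have "surj (\<lambda>u :: real^'p::{finite,linorder}. u v* R1)"
    proof (rule surjI)
      show "upper_rows ((?P *v u) v* ?Q) v* R1 = u" for u
        using C_Q[of "(?P *v u) v* ?Q"] by (simp add: Q_inv CP)
    qed
    then have "inj (\<lambda>u :: real^'p::{finite,linorder}. u v* R1)" by (rule linear_surjective_imp_injective[OF lin]) (rule refl)
    moreover have "(v v* Q1) v* R1 = 0"
      using C_Q[of "v v* ?Q"] that unfolding Q_inv by (simp add: Q_vec)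
    ultimately have "v v* Q1 = 0" by (metis injD vector_matrix_mult_0)
    then show ?thesis using Q_inv[of v] by (simp add: Q_vec hcat_vappend)
  qed
  have uCQ: "(u v* C) v* Q2 = 0" for u
    by (rule vector_eq_rdot[THEN iffD1]) (simp add: dot_lmul_matrix CQ)
  have PQ: "(?P *v u) v* Q2 = 0" for u
    unfolding pinv_range[OF rank_C, of u] by (rule uCQ)
  \<comment> \<open>the genericity condition as a gap between minimal gains\<close>
  have \<sigma>B: "\<sigma>bar * norm y \<le> norm (?B *v y)" for y
    unfolding sigmabar_def k(1) by (rule last_singular_value_minimal_gain(2))
  have \<sigma>0: "0 \<le> \<sigma>tilde"
    unfolding sigmatilde_def k(2) by (rule last_singular_value_minimal_gain(1))
  obtain z where z: "z \<noteq> 0"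
    "(transpose (augment ?B (\<zeta> *\<^sub>R rC)) ** augment ?B (\<zeta> *\<^sub>R rC)) *v z = \<sigma>tilde\<^sup>2 *\<^sub>R z"
    using last_singular_value_minimal_gain(3)[of "augment ?B (\<zeta> *\<^sub>R rC)"]
    unfolding sigmatilde_def k(2) by blast
  have gap: "\<sigma>tilde\<^sup>2 * (norm y)\<^sup>2 < (norm (?B *v y))\<^sup>2" if "y \<noteq> 0" for y
  proof -
    have "\<sigma>tilde * norm y < \<sigma>bar * norm y" using genericity that by simp
    also note \<sigma>B
    finally have "(\<sigma>tilde * norm y)\<^sup>2 < (norm (?B *v y))\<^sup>2"
      using \<sigma>0 by (intro power_strict_mono) simp_all
    then show ?thesis by (simp add: power_mult_distrib)
  qed
  obtain x0 t0 where crit: "tlse_critical L h x0 t0" and ht: "h \<bullet> t0 = - \<sigma>tilde\<^sup>2"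
    using tlse_critical_from_singular_vector[OF CQ QQ ker CP _ _ zeta_def \<sigma>B \<sigma>0 genericity z(1), of d b]
      z(2) CP[of d] PQ[of d]
    unfolding L_def h_def rC_def xC_def by blast
  have pos: "- (h \<bullet> t0) * (norm v)\<^sup>2 < (norm (lower_rows L *v v))\<^sup>2"
    if "v \<noteq> 0" "upper_rows L *v v = 0" for v
  proof -
    define y where "y = v v* Q2"
    have v: "v = Q2 *v y" using ker[of v] that(2) by (simp add: y_def L_def)
    then have "y \<noteq> 0" using that(1) by auto
    have "v \<bullet> v = y \<bullet> y" unfolding v using QQ[of y] by (simp add: dot_lmul_matrix[symmetric])
    then have "(norm v)\<^sup>2 = (norm y)\<^sup>2" by (simp add: power2_norm_eq_inner)
    moreover have "lower_rows L *v v = ?B *v y" by (simp add: L_def v matrix_vector_mul_assoc)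
    ultimately show ?thesis using gap[OF \<open>y \<noteq> 0\<close>] by (simp only: ht minus_minus)
  qed
  \<comment> \<open>the matrix \<open>K\<close> inverts the reduced Hessian on the kernel of \<open>C\<close>\<close>
  have S11_mult: "S11 *v y = (?B *v y) v* ?B - \<sigma>tilde\<^sup>2 *\<^sub>R y" for y
    by (simp add: S11_def matrix_vector_mult_diff_rdistrib matrix_vector_mul_assoc[symmetric]
        vector_matrix_mul_assoc[symmetric] scaleR_matrix_vector_assoc[symmetric])
  have S11_inv: "matrix_inv S11 ** S11 = mat 1"
  proof (rule matrix_inv_injective)
    fix y assume "S11 *v y = 0"
    then have "(S11 *v y) \<bullet> y = 0" by simp
    then have "(norm (?B *v y))\<^sup>2 = \<sigma>tilde\<^sup>2 * (norm y)\<^sup>2"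
      by (simp add: S11_mult inner_diff_left dot_lmul_matrix power2_norm_eq_inner)
    then show "y = 0" using gap[of y] by (cases "y = 0") simp_all
  qed
  have K_mult: "K *v v = Q2 *v (matrix_inv S11 *v (v v* Q2))" for v
    by (simp add: K_def matrix_vector_mul_assoc[symmetric])
  have KC: "K *v (u v* C) = 0" for u by (simp add: K_mult uCQ)
  have KP: "K *v (?P *v u) = 0" for u by (simp add: K_mult PQ)
  have KS: "K *v ((A *v w) v* A + (h \<bullet> t0) *\<^sub>R w) = w" if "C *v w = 0" for w
  proof -
    define y where "y = w v* Q2"
    have w: "w = Q2 *v y" using ker[OF that] by (simp add: y_def)
    have "((A *v w) v* A + (h \<bullet> t0) *\<^sub>R w) v* Q2 = S11 *v y"
      unfolding S11_mult ht
      by (simp add: w vector_matrix_left_distrib vector_matrix_mul_assoc[symmetric] QQ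
          matrix_vector_mul_assoc[symmetric] scaleR_vector_matrix_assoc[of "- _", simplified]
          vector_matrix_mult_diff_distrib scaleR_vector_matrix_assoc)
    then have "K *v ((A *v w) v* A + (h \<bullet> t0) *\<^sub>R w) = Q2 *v ((matrix_inv S11 ** S11) *v y)"
      by (simp add: K_mult matrix_vector_mul_assoc)
    then show ?thesis by (simp add: S11_inv w)
  qed
  have H1_mult: "H1 *v c = (2 / (1 + (norm x0)\<^sup>2) * (t \<bullet> c)) *\<^sub>R (K *v x)
      - (?P *v upper_rows c - K *v ((A *v (?P *v upper_rows c)) v* A)) - K *v (lower_rows c v* A)"
    if "x = x0" for c
  proof -
    have "((columnvector x :: real^1^'n) ** (rowvector t :: real^('p + 'q)^1)) *v c = (t \<bullet> c) *\<^sub>R x"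
      by (simp add: vec_eq_iff matrix_matrix_mult_def matrix_vector_mult_def columnvector_def rowvector_def
          inner_vec_def sum_distrib_left sum_distrib_right mult_ac)
    then have "(K ** (columnvector x :: real^1^'n) ** (rowvector t :: real^('p + 'q)^1)) *v c
        = (t \<bullet> c) *\<^sub>R (K *v x)"
      by (metis matrix_mul_assoc matrix_vector_mul_assoc matrix_vector_mult_scaleR)
    moreover have "\<rho>\<^sup>2 = 1 + (norm x0)\<^sup>2"
      unfolding rho_def that by (simp add: add_nonneg_nonneg)
    ultimately show ?thesis
      by (simp add: H1_def matrix_vector_mult_diff_rdistrib scaleR_matrix_vector_assoc[symmetric]
          hcat_mult CA_def matrix_vector_mul_assoc[symmetric])
  qed
  have Kblock_mult: "Kblock *v vappend (vec_cols \<Delta>L) \<Delta>h = H1 *v (\<Delta>L *v x - \<Delta>h) - K *v (t v* \<Delta>L)" for \<Delta>L \<Delta>h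
  proof -
    have "(- H1) *v \<Delta>h = - (H1 *v \<Delta>h)"
      by (simp add: vec_eq_iff matrix_vector_mult_def sum_negf)
    then show ?thesis
      by (simp add: Kblock_def hcat_vappend matrix_vector_mult_diff_rdistrib kronecker_rowvector_vec_cols
          H2_def matrix_vector_mul_assoc[symmetric] kronecker_mat_1_vec_cols matrix_vector_mult_diff_distrib)
  qed
  have Kbar_mult: "Kbar *v vec_cols (augment \<Delta>L \<Delta>h) = Kblock *v vappend (vec_cols \<Delta>L) \<Delta>h" for \<Delta>L \<Delta>h
    unfolding Kbar_def by (rule reindex_cols_vec_cols_augment)
  have up: "upper_rows L = C" and low: "lower_rows L = A" by (simp_all add: L_def)
  have x0: "x = x0"
    unfolding x_def tlse_map_def
    by (rule the_equality) (simp_all add: tlse_critical_unique_solution[OF crit pos])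
  have r: "r = lower_rows t0"
    using arg_cong[of _ _ lower_rows, OF conjunct2[OF crit[unfolded tlse_critical_def]]]
    by (simp add: rows_matrix_vector_mult L_def h_def r_def x0)
  have t: "t = t0"
    using tlse_multiplier_pinv[OF crit[unfolded L_def h_def] rank_C] by (simp add: t_def r)
  have D: "fst \<delta> = Kbar *v vec_cols (augment (fst \<Delta>) (snd \<Delta>))"
    if "kkt_jacobian L h x0 t0 \<delta> + kkt_data_derivative x0 t0 \<Delta> = 0" for \<Delta> \<delta>
    using tlse_derivative_formula[OF crit, of "fst \<delta>" "snd \<delta>" "fst \<Delta>" "snd \<Delta>" K ?P, unfolded up low]
      that KC KS CP KP
    by (simp add: Kbar_mult Kblock_mult H1_mult[OF x0] x0 t)
  note expansion = tlse_map_expansion[OF crit _ rank_L pos D, unfolded up, OF rank_C]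
  have aug: "(norm (augment (fst \<Delta>) (snd \<Delta>)))\<^sup>2 = (norm \<Delta>)\<^sup>2" for \<Delta> :: "(real^'n^('p + 'q)) \<times> (real^('p + 'q))"
    by (simp add: norm_augment)
  show ?thesis
    using expansion Kbar_mult
    by (simp add: case_prod_unfold aug zero_prod_def[symmetric] flip: x0)
qed

end
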